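(* Let $\boldsymbol{X}$ be a $d$-dimensional random vector having the truncated multivariate normal density with parameters $\boldsymbol{\mu}\in\mathbb{R}^d$ and $\boldsymbol{\Sigma}$ (a positive definite symmetric $d\times d$ matrix), $$f(\boldsymbol{x};\boldsymbol{\mu},\boldsymbol{\Sigma})=[C(\boldsymbol{\mu},\boldsymbol{\Sigma})]^{-1}\exp\big[-\tfrac12(\boldsymbol{x}-\boldsymbol{\mu})'\boldsymbol{\Sigma}^{-1}(\boldsymbol{x}-\boldsymbol{\mu})\big],\quad \boldsymbol{x}\in\mathbb{R}_+^d,$$ and let $\boldsymbol{x}_1,\ldots,\boldsymbol{x}_n$ be a random sample from $\boldsymbol{X}$. Put $\boldsymbol{T}_1=\overline{\boldsymbol{x}}=n^{-1}\sum_{j=1}^n\boldsymbol{x}_j$, $\boldsymbol{T}_2=n^{-1}\sum_{j=1}^n\boldsymbol{x}_j\boldsymbol{x}_j'$, and $$\mathcal{C}_d=\{(\boldsymbol{\theta},\boldsymbol{\Theta})\in\mathbb{R}_+^d\times\mathcal{S}^{d\times d}:\boldsymbol{\Theta}\succcurlyeq\boldsymbol{\theta}\boldsymbol{\theta}'\}.$$ Then: (i) The pair of statistics $(\boldsymbol{T}_1,\boldsymbol{T}_2)$ is sufficient for $(\boldsymbol{\mu},\boldsymbol{\Sigma})$. (ii) The set $\mathcal{C}_d$ is closed, convex, and contains the convex support of $\beta_{(\boldsymbol{T}_1,\boldsymbol{T}_2)}$, the distribution of $(\boldsymbol{T}_1,\boldsymbol{T}_2)$. (iii) If $n>d$ then,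 with probability one, $(\boldsymbol{T}_1,\boldsymbol{T}_2)\in\mathrm{Int}(\mathcal{C}_d)$, and if the likelihood function has a maximizer on $\mathcal{D}$ then that maximizer is unique.
   Context: Notation: $\mathbb{R}_+^d$ is the nonnegative orthant; a prime denotes transpose; $\mathcal{S}^{d\times d}$ is the space of real symmetric $d\times d$ matrices; $\boldsymbol{A}\succcurlyeq\boldsymbol{B}$ means $\boldsymbol{A}-\boldsymbol{B}$ is positive semidefinite; $\mathrm{Int}$ is the interior in $\mathbb{R}^d\times\mathcal{S}^{d\times d}$. The normalizing constant is $$C(\boldsymbol{\mu},\boldsymbol{\Sigma})=\int_{\mathbb{R}_+^d}\exp\big[-\tfrac12(\boldsymbol{w}-\boldsymbol{\mu})'\boldsymbol{\Sigma}^{-1}(\boldsymbol{w}-\boldsymbol{\mu})\big]\,d\boldsymbol{w}.$$ The convex support of a measure is the closed convex hull of its support. The canonical parameters are $\boldsymbol{\theta}=\boldsymbol{\Sigma}^{-1}\boldsymbol{\mu}$ and $\boldsymbol{\Theta}=\tfrac12\boldsymbol{\Sigma}^{-1}$. The extended family of truncated multivariate normal distributions consists of the densities $p(\boldsymbol{t};\boldsymbol{\theta},\boldsymbol{\Theta})=\exp(\boldsymbol{\theta}'\boldsymbol{t}-\boldsymbol{t}'\boldsymbol{\Theta}\boldsymbol{t})/L_T(\boldsymbol{\theta},\boldsymbol{\Theta})$, $\boldsymbol{t}\in\mathbb{R}_+^d$, with $$L_T(\boldsymbol{\theta},\boldsymbol{\Theta})=\int_{\mathbb{R}_+^d}\exp(\boldsymbol{\theta}'\boldsymbol{w}-\boldsymbol{w}'\boldsymbol{\Theta}\boldsymbol{w})\,d\boldsymbol{w},$$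 for $(\boldsymbol{\theta},\boldsymbol{\Theta})$ in the canonical parameter space $\mathcal{D}=\{(\boldsymbol{\theta},\boldsymbol{\Theta})\in\mathbb{R}^d\times\mathcal{S}^{d\times d}:L_T(\boldsymbol{\theta},\boldsymbol{\Theta})<\infty\}$. The likelihood function on $\mathcal{D}$ is $(\boldsymbol{\theta},\boldsymbol{\Theta})\mapsto\prod_{j=1}^n p(\boldsymbol{x}_j;\boldsymbol{\theta},\boldsymbol{\Theta})$. *)

theory Defs
  imports "HOL-Probability.Probability"
begin

definition nonneg_orthant :: "(real^'d) set" where
  "nonneg_orthant = {w. \<forall>i. 0 \<le> w $ i}"

definition sym_matrix :: "real^'d^'d \<Rightarrow> bool" where
  "sym_matrix A \<longleftrightarrow> transpose A = A"

definition psd_matrix :: "real^'d^'d \<Rightarrow> bool" where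
  "psd_matrix A \<longleftrightarrow> sym_matrix A \<and> (\<forall>v. 0 \<le> v \<bullet> (A *v v))"

definition pd_matrix :: "real^'d^'d \<Rightarrow> bool" where
  "pd_matrix A \<longleftrightarrow> sym_matrix A \<and> (\<forall>v. v \<noteq> 0 \<longrightarrow> 0 < v \<bullet> (A *v v))"

definition outer :: "real^'d \<Rightarrow> real^'d \<Rightarrow> real^'d^'d" where
  "outer u v = (\<chi> i j. u $ i * v $ j)"


subsection \<open>The truncated normal density\<close>

definition tmvn_kernel :: "real^'d \<Rightarrow> real^'d^'d \<Rightarrow> real^'d \<Rightarrow> real" where
  "tmvn_kernel \<mu> \<Sigma> w = exp (- (1/2) * ((w - \<mu>) \<bullet> (matrix_inv \<Sigma> *v (w - \<mu>))))"

definition tmvn_const :: "real^'d \<Rightarrow> real^'d^'d \<Rightarrow> real" where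
  "tmvn_const \<mu> \<Sigma> = (LINT w:nonneg_orthant|lborel. tmvn_kernel \<mu> \<Sigma> w)"

definition tmvn_density :: "real^'d \<Rightarrow> real^'d^'d \<Rightarrow> real^'d \<Rightarrow> real" where
  "tmvn_density \<mu> \<Sigma> w =
     indicator nonneg_orthant w * (inverse (tmvn_const \<mu> \<Sigma>) * tmvn_kernel \<mu> \<Sigma> w)"


subsection \<open>The extended family in canonical parameters\<close>

definition L_T :: "real^'d \<Rightarrow> real^'d^'d \<Rightarrow> ennreal" where
  "L_T \<theta> \<Theta> =
     (\<integral>\<^sup>+ w. ennreal (exp (\<theta> \<bullet> w - w \<bullet> (\<Theta> *v w))) * indicator nonneg_orthant w \<partial>lborel)"

definition canonical_space :: "((real^'d) \<times> (real^'d^'d)) set" where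
  "canonical_space = {(\<theta>, \<Theta>). sym_matrix \<Theta> \<and> L_T \<theta> \<Theta> < \<infinity>}"

definition canonical_density :: "real^'d \<Rightarrow> real^'d^'d \<Rightarrow> real^'d \<Rightarrow> real" where
  "canonical_density \<theta> \<Theta> t =
     indicator nonneg_orthant t * (exp (\<theta> \<bullet> t - t \<bullet> (\<Theta> *v t)) / enn2real (L_T \<theta> \<Theta>))"

definition likelihood :: "nat \<Rightarrow> (nat \<Rightarrow> real^'d) \<Rightarrow> (real^'d) \<times> (real^'d^'d) \<Rightarrow> real" where
  "likelihood n x = (\<lambda>(\<theta>, \<Theta>). \<Prod>j=1..n. canonical_density \<theta> \<Theta> (x j))"


subsection \<open>The statistics and the set \<open>\<C>\<^sub>d\<close>\<close>

definition T1 :: "nat \<Rightarrow> (nat \<Rightarrow> real^'d) \<Rightarrow> real^'d" where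
  "T1 n x = (1 / real n) *\<^sub>R (\<Sum>j=1..n. x j)"

definition T2 :: "nat \<Rightarrow> (nat \<Rightarrow> real^'d) \<Rightarrow> real^'d^'d" where
  "T2 n x = (1 / real n) *\<^sub>R (\<Sum>j=1..n. outer (x j) (x j))"

definition T12 :: "nat \<Rightarrow> (nat \<Rightarrow> real^'d) \<Rightarrow> (real^'d) \<times> (real^'d^'d)" where
  "T12 n x = (T1 n x, T2 n x)"

definition C_set :: "((real^'d) \<times> (real^'d^'d)) set" where
  "C_set = {(\<theta>, \<Theta>). \<theta> \<in> nonneg_orthant \<and> sym_matrix \<Theta> \<and> psd_matrix (\<Theta> - outer \<theta> \<theta>)}"

text \<open>
  The space \<open>\<real>\<^sup>d \<times> \<S>\<close> of pairs with symmetric second component.  It has empty interior among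
  all pairs, so interiors of its subsets have to be taken in the subspace topology.
\<close>
definition vec_sym_space :: "((real^'d) \<times> (real^'d^'d)) set" where
  "vec_sym_space = {(\<theta>, \<Theta>). sym_matrix \<Theta>}"


subsection \<open>Sufficiency and convex support\<close>

text \<open>
  Sufficiency in the sense of Halmos and Savage: for every event \<open>A\<close> of the sample space \<open>N\<close>, the
  conditional probability of \<open>A\<close> given \<open>T\<close> has a version \<open>g \<circ> T\<close> that is the same for all
  parameters \<open>p \<in> \<Theta>\<close> of the model \<open>P\<close>.
\<close>
definition sufficient ::
    "'a measure \<Rightarrow> 'p set \<Rightarrow> ('p \<Rightarrow> 'a measure) \<Rightarrow> 'b measure \<Rightarrow> ('a \<Rightarrow> 'b) \<Rightarrow> bool" where
  "sufficient N \<Theta> P S T \<longleftrightarrow>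
     (\<forall>p\<in>\<Theta>. prob_space (P p) \<and> sets (P p) = sets N) \<and>
     T \<in> measurable N S \<and>
     (\<forall>A\<in>sets N. \<exists>g::'b \<Rightarrow> real. g \<in> borel_measurable S \<and>
        (\<forall>p\<in>\<Theta>. AE x in P p.
           real_cond_exp (P p) (vimage_algebra (space N) T S) (indicator A) x = g (T x)))"

text \<open>
  The law of a sample \<open>x\<^sub>1, \<dots>, x\<^sub>n\<close>, on functions from the index set \<open>{1..n}\<close>.
\<close>
definition sample_law :: "nat \<Rightarrow> (real^'d) \<times> (real^'d^'d) \<Rightarrow> (nat \<Rightarrow> real^'d) measure" where
  "sample_law n = (\<lambda>(\<mu>, \<Sigma>).
     PiM {1..n} (\<lambda>_. density lborel (\<lambda>w. ennreal (tmvn_density \<mu> \<Sigma> w))))"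

definition measure_support :: "'a::topological_space measure \<Rightarrow> 'a set" where
  "measure_support \<nu> = {z. \<forall>U. open U \<longrightarrow> z \<in> U \<longrightarrow> emeasure \<nu> U > 0}"

definition convex_support :: "'a::real_normed_vector measure \<Rightarrow> 'a set" where
  "convex_support \<nu> = closure (convex hull (measure_support \<nu>))"

end

theory Submission
  imports Defs
begin

text \<open>
  The truncated normal densities form an exponential family on the orthant.  Expanding the square,
  the density at \<open>w\<close> is a constant times \<open>exp (\<theta> \<bullet> w - w \<bullet> (\<Theta> *v w))\<close>, and the exponent depends linearly
  on the statistic \<open>(w, w w')\<close>.  Sufficiency and the uniqueness of the maximizer rest on
  this linearity; the statements on \<open>C_set\<close> are geometry.

  Sufficiency is the factorization criterion.  Relative to the sample law with parameters
  \<open>0\<close> and \<open>mat 1\<close>, every other sample law has a density that is a function of the means of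
  \<open>w\<close> and \<open>w w'\<close> (\<open>PiM_density\<close>, \<open>sum_pairing_natural_stat\<close>).  Such a density enters both sides
  of the identity that defines the conditional probability given \<open>T12\<close> as the same factor, so one
  version serves all parameters (\<open>sufficient_of_factorization\<close>).

  A pair \<open>(\<theta>, \<Theta>)\<close> with \<open>\<theta>\<close> in the orthant and \<open>\<Theta>\<close> symmetric lies in \<open>C_set\<close> iff
  \<open>(\<theta> \<bullet> v)\<^sup>2 \<le> v \<bullet> (\<Theta> *v v)\<close> for all \<open>v\<close>.  For each \<open>v\<close> this is a closed condition, and a convex one
  because squaring is convex.  At \<open>T12\<close> the difference of the two sides is the sample variance of
  \<open>x\<^sub>j \<bullet> v\<close>, so \<open>T12\<close> is in \<open>C_set\<close>; it is an interior point as soon as all coordinates of the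
  observations are positive and every sample variance with \<open>v \<noteq> 0\<close> is positive.  The variances
  are positive unless the observations lie on a common hyperplane.  Picking \<open>d + 1\<close> of them, this
  would make the determinant of the \<open>d\<close> differences to one observation vanish, and a nonzero
  function that is affine in each observation separately vanishes only on a null set
  (\<open>AE_multiaffine_nonzero\<close>).

  The maximizer is unique because the logarithm of the partition function is strictly convex on the
  canonical parameter space (\<open>midpoint_canonical_space\<close>), while the rest of the log-likelihood is
  linear.  Strictness comes from identifiability: a linear function of \<open>(w, w w')\<close>, with a symmetric
  coefficient matrix, that is almost everywhere constant on the orthant is zero (\<open>pairing_constant_on_orthant_imp_zero\<close>).  Hence
  the midpoint of two distinct maximizers would have a larger likelihood than both of them.
\<close>

section \<open>Quadratic forms and positive definite matrices\<close>

lemma inner_mult_vec_eq_sum: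
  fixes A :: "real^'n^'n"
  shows "v \<bullet> (A *v w) = (\<Sum>i\<in>UNIV. \<Sum>j\<in>UNIV. v $ i * A $ i $ j * w $ j)"
  by (simp add: inner_vec_def matrix_vector_mult_def sum_distrib_left mult.assoc)

text \<open>
  Turns a quadratic form into something linear in \<open>outer w w\<close>, so that it can be averaged over a sample.
\<close>
lemma quadratic_form_eq_inner_outer:
  fixes A :: "real^'n^'n"
  shows "w \<bullet> (A *v w) = A \<bullet> outer w w"
  unfolding inner_mult_vec_eq_sum outer_def
  by (simp add: inner_vec_def mult_ac)

lemma quadratic_form_outer:
  fixes u v :: "real^'n"
  shows "v \<bullet> (outer u u *v v) = (u \<bullet> v)\<^sup>2"
  unfolding quadratic_form_eq_inner_outer power2_eq_square
  by (simp add: outer_def inner_vec_def sum_product mult_ac)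

lemma continuous_on_quadratic_form [continuous_intros]:
  fixes A :: "'a::topological_space \<Rightarrow> real^'n^'n"
  assumes "continuous_on S A" "continuous_on S v" "continuous_on S w"
  shows "continuous_on S (\<lambda>z. v z \<bullet> (A z *v w z))"
  unfolding inner_mult_vec_eq_sum
  by (intro continuous_intros assms)

lemma continuous_on_outer [continuous_intros]:
  assumes "continuous_on S v" "continuous_on S w"
  shows "continuous_on S (\<lambda>z. outer (v z) (w z))"
  unfolding outer_def by (intro continuous_intros assms)

text \<open>
  The constant is the minimum of the quadratic form on the unit sphere, which is attained and
  positive by compactness; homogeneity does the rest.
\<close>
lemma pd_matrix_coercive:
  fixes A :: "real^'n^'n"
  assumes "pd_matrix A"
  obtains c where "c > 0" "\<And>v. c * (norm v)\<^sup>2 \<le> v \<bullet> (A *v v)"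
proof -
  have "compact (sphere 0 1 :: (real^'n) set)" "sphere 0 1 \<noteq> ({} :: (real^'n) set)"
    by auto
  moreover have "continuous_on (sphere 0 1) (\<lambda>v::real^'n. v \<bullet> (A *v v))"
    by (intro continuous_intros)
  ultimately obtain u where u: "u \<in> sphere 0 1"
      "\<And>v. v \<in> sphere 0 1 \<Longrightarrow> u \<bullet> (A *v u) \<le> v \<bullet> (A *v v)"
    using continuous_attains_inf by metis
  show ?thesis
  proof
    show "u \<bullet> (A *v u) > 0"
      using assms u(1) unfolding pd_matrix_def by (metis norm_zero mem_sphere_0 zero_neq_one)
    show "(u \<bullet> (A *v u)) * (norm v)\<^sup>2 \<le> v \<bullet> (A *v v)" for v
    proof (cases "v = 0")
      case False
      define w where "w = v /\<^sub>R norm v"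
      have "w \<in> sphere 0 1" and v: "v = norm v *\<^sub>R w"
        using False by (auto simp: w_def)
      then have "u \<bullet> (A *v u) \<le> w \<bullet> (A *v w)" by (intro u)
      moreover have "v \<bullet> (A *v v) = (norm v)\<^sup>2 * (w \<bullet> (A *v w))"
        by (subst (1 2) v) (simp add: matrix_vector_mult_scaleR power2_eq_square)
      ultimately show ?thesis
        by (simp add: mult.commute mult_right_mono)
    qed simp
  qed
qed

text \<open>
  With \<open>w = A\<^sup>-\<^sup>1 v\<close> the quadratic form of \<open>A\<^sup>-\<^sup>1\<close> at \<open>v\<close> is the one of \<open>A\<close> at \<open>w\<close>.
\<close>
lemma pd_matrix_matrix_inv:
  fixes A :: "real^'n^'n"
  assumes "pd_matrix A"
  shows "pd_matrix (matrix_inv A)"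
proof -
  have "inj ((*v) A)"
  proof (subst linear_injective_0)
    show "\<forall>v. A *v v = 0 \<longrightarrow> v = 0"
      using assms by (metis inner_zero_right less_irrefl pd_matrix_def)
  qed simp
  then have "invertible A"
    by (simp add: invertible_left_inverse matrix_left_invertible_injective)
  then have AB: "A ** matrix_inv A = mat 1" and BA: "matrix_inv A ** A = mat 1"
    unfolding invertible_def matrix_inv_def by (metis (mono_tags, lifting) someI_ex)+
  have sym: "transpose A = A"
    using assms by (simp add: pd_matrix_def sym_matrix_def)
  have "transpose (matrix_inv A) ** A = mat 1"
    by (metis AB sym matrix_transpose_mul transpose_mat)
  then have "transpose (matrix_inv A) = matrix_inv A"
    by (metis AB matrix_mul_assoc matrix_mul_lid matrix_mul_rid)
  moreover have "0 < v \<bullet> (matrix_inv A *v v)" if "v \<noteq> 0" for v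
  proof -
    define w where "w = matrix_inv A *v v"
    have v: "v = A *v w"
      by (simp add: w_def matrix_vector_mul_assoc AB)
    then have "w \<noteq> 0" using that by auto
    then have "0 < w \<bullet> (A *v w)" using assms by (simp add: pd_matrix_def)
    then show ?thesis by (metis v w_def inner_commute)
  qed
  ultimately show ?thesis by (simp add: pd_matrix_def sym_matrix_def)
qed

section \<open>The normal density on the orthant\<close>

lemma closed_nonneg_orthant: "closed (nonneg_orthant :: (real^'d) set)"
  unfolding nonneg_orthant_def by (intro closed_Collect_all closed_Collect_le continuous_intros)

lemma nonneg_orthant_borel [measurable]: "(nonneg_orthant :: (real^'d) set) \<in> sets borel"
  by (intro borel_closed closed_nonneg_orthant)

definition pos_orthant :: "(real^'d) set" where
  "pos_orthant = {w. \<forall>i. 0 < w $ i}"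

lemma open_pos_orthant: "open (pos_orthant :: (real^'d) set)"
  unfolding pos_orthant_def Collect_all_eq by (intro open_INT ballI open_Collect_less continuous_intros) simp

lemma pos_orthant_subset: "pos_orthant \<subseteq> nonneg_orthant"
  by (auto simp: pos_orthant_def nonneg_orthant_def less_imp_le)

text \<open>
  A nonempty open set is never a null set, so an open set of exceptions must be empty.
\<close>
lemma AE_lborel_open_imp_all:
  fixes U :: "'a::euclidean_space set"
  assumes "AE w in lborel. w \<in> U \<longrightarrow> P w" "open U" "open {w \<in> U. \<not> P w}" "w \<in> U"
  shows "P w"
proof (rule ccontr)
  assume "\<not> P w"
  have "AE w in lborel. w \<notin> {w \<in> U. \<not> P w}"
    using assms(1) by eventually_elim auto
  then have "{w \<in> U. \<not> P w} \<in> null_sets lborel"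
    using assms(3) by (subst AE_iff_null_sets) auto
  then have "negligible {w \<in> U. \<not> P w}"
    by (simp add: negligible_iff_null_sets null_sets_completionI)
  then show False
    using open_not_negligible[OF assms(3)] \<open>\<not> P w\<close> assms(4) by blast
qed

text \<open>
  The orthant contains the nonempty open set \<open>pos_orthant\<close>, hence is not a null set.
\<close>
lemma nn_integral_orthant_pos:
  fixes f :: "real^'d \<Rightarrow> ennreal"
  assumes [measurable]: "f \<in> borel_measurable borel" and pos: "\<And>w. f w > 0"
  shows "(\<integral>\<^sup>+w. f w * indicator nonneg_orthant w \<partial>lborel) > 0"
proof (rule ccontr)
  assume "\<not> ?thesis"
  then have "AE w in lborel. f w * indicator nonneg_orthant w = 0"
    by (subst (asm) not_gr_zero, subst (asm) nn_integral_0_iff_AE) auto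
  then have "AE w in lborel. w \<in> (pos_orthant :: (real^'d) set) \<longrightarrow> False"
  proof eventually_elim
    case (elim w)
    then show ?case
      using pos[of w] pos_orthant_subset by (auto split: split_indicator_asm)
  qed
  moreover have "(\<chi> i. 1) \<in> (pos_orthant :: (real^'d) set)"
    by (simp add: pos_orthant_def)
  ultimately show False
    using AE_lborel_open_imp_all[of pos_orthant "\<lambda>_. False"] open_pos_orthant by auto
qed

text \<open>
  The integrand is a product over the coordinates, and each factor is a multiple of a normal density
  on the line.
\<close>
lemma nn_integral_gaussian_finite:
  fixes c :: real
  assumes "c > 0"
  shows "(\<integral>\<^sup>+w. ennreal (exp (- c * (norm (w::'a::euclidean_space))\<^sup>2)) \<partial>lborel) < \<infinity>"
proof -
  \<comment> \<open>The standard deviation for which \<open>1 / (2 * \<sigma>\<^sup>2) = c\<close>.\<close>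
  define \<sigma> where "\<sigma> = sqrt (1 / (2 * c))"
  have \<sigma>: "\<sigma> > 0" "\<sigma>\<^sup>2 = 1 / (2 * c)"
    using assms by (auto simp: \<sigma>_def)
  have one_dim: "(\<integral>\<^sup>+t. ennreal (exp (- c * t\<^sup>2)) \<partial>lborel) < \<infinity>"
  proof -
    have "integrable lborel (\<lambda>t. sqrt (2 * pi * \<sigma>\<^sup>2) * normal_density 0 \<sigma> t)"
      using \<sigma>(1) by (intro integrable_mult_right) simp
    moreover have "(\<lambda>t. sqrt (2 * pi * \<sigma>\<^sup>2) * normal_density 0 \<sigma> t) = (\<lambda>t. exp (- c * t\<^sup>2))"
      using assms by (auto simp: normal_density_def fun_eq_iff \<sigma>)
    ultimately have "integrable lborel (\<lambda>t. exp (- c * t\<^sup>2))" by simp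
    then show ?thesis
      by (subst (asm) integrable_iff_bounded) simp
  qed
  have "exp (- c * (norm w)\<^sup>2) = (\<Prod>b\<in>Basis. exp (- c * (w \<bullet> b)\<^sup>2))" for w :: 'a
    unfolding power2_norm_eq_inner euclidean_inner[of w w]
    by (subst exp_sum[symmetric]) (simp_all add: sum_distrib_left power2_eq_square)
  then have "(\<integral>\<^sup>+w. ennreal (exp (- c * (norm (w::'a))\<^sup>2)) \<partial>lborel)
    = (\<integral>\<^sup>+w. (\<Prod>b\<in>Basis. ennreal (exp (- c * ((w::'a) \<bullet> b)\<^sup>2))) \<partial>lborel)"
    by (simp add: prod_ennreal)
  also have "\<dots> = (\<Prod>b\<in>(Basis::'a set). \<integral>\<^sup>+t. ennreal (exp (- c * t\<^sup>2)) \<partial>lborel)"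
    by (subst nn_integral_lborel_prod) auto
  also have "\<dots> < \<infinity>"
    using one_dim by (simp add: power_less_top_ennreal)
  finally show ?thesis .
qed

section \<open>The canonical exponential form\<close>

definition natural_stat :: "real^'d \<Rightarrow> (real^'d) \<times> (real^'d^'d)" where
  "natural_stat w = (w, outer w w)"

text \<open>
  The sign of the second component is chosen so that \<open>exp (pairing p (natural_stat w))\<close> is the
  unnormalized density with canonical parameter \<open>p\<close>.
\<close>
definition pairing :: "(real^'d) \<times> (real^'d^'d) \<Rightarrow> (real^'d) \<times> (real^'d^'d) \<Rightarrow> real" where
  "pairing p t = fst p \<bullet> fst t - snd p \<bullet> snd t"

lemma pairing_natural_stat:
  "pairing (\<theta>, \<Theta>) (natural_stat w) = \<theta> \<bullet> w - w \<bullet> (\<Theta> *v w)"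
  by (simp add: pairing_def natural_stat_def quadratic_form_eq_inner_outer)

lemma linear_pairing_right: "linear (pairing p)"
  by (rule linearI) (simp_all add: pairing_def inner_simps algebra_simps)

lemma linear_pairing_left: "linear (\<lambda>p. pairing p t)"
  by (rule linearI) (simp_all add: pairing_def inner_simps algebra_simps)

lemma continuous_on_natural_stat [continuous_intros]:
  "continuous_on S f \<Longrightarrow> continuous_on S (\<lambda>z. natural_stat (f z))"
  unfolding natural_stat_def by (intro continuous_intros)

lemma continuous_on_pairing [continuous_intros]:
  "continuous_on S f \<Longrightarrow> continuous_on S (\<lambda>z. pairing p (f z))"
  unfolding pairing_def by (intro continuous_intros)

lemma borel_measurable_natural_stat [measurable]:
  "natural_stat \<in> borel_measurable borel"
  by (intro borel_measurable_continuous_onI continuous_intros)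

lemma borel_measurable_pairing [measurable]:
  "pairing p \<in> borel_measurable borel"
  by (intro borel_measurable_continuous_onI continuous_intros)

lemma T12_eq_mean: "T12 n x = (1 / real n) *\<^sub>R (\<Sum>j=1..n. natural_stat (x j))"
  by (simp add: T12_def T1_def T2_def natural_stat_def sum_prod scaleR_prod_def)

lemma sum_pairing_natural_stat:
  assumes "n \<ge> 1"
  shows "(\<Sum>j=1..n. pairing p (natural_stat (x j))) = real n * pairing p (T12 n x)"
  using assms
  by (simp add: T12_eq_mean linear_scale[OF linear_pairing_right] linear_sum[OF linear_pairing_right])

text \<open>
  Completing the square backwards: the canonical parameters of the truncated normal density are
  \<open>S\<^sup>-\<^sup>1 m\<close> and \<open>(1/2) S\<^sup>-\<^sup>1\<close>.
\<close>
lemma tmvn_kernel_canonical: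
  fixes S :: "real^'d^'d"
  assumes "pd_matrix S"
  defines "A \<equiv> matrix_inv S"
  shows "tmvn_kernel m S w =
    exp (- (1/2) * (m \<bullet> (A *v m))) * exp (pairing (A *v m, (1/2) *\<^sub>R A) (natural_stat w))"
proof -
  have "transpose A = A"
    using pd_matrix_matrix_inv[OF assms(1)] by (simp add: A_def pd_matrix_def sym_matrix_def)
  then have sym: "w \<bullet> (A *v m) = m \<bullet> (A *v w)"
    by (metis dot_lmul_matrix inner_commute transpose_matrix_vector)
  have "(w - m) \<bullet> (A *v (w - m)) = w \<bullet> (A *v w) - 2 * (w \<bullet> (A *v m)) + m \<bullet> (A *v m)"
    using sym by (simp add: matrix_vector_mult_diff_distrib inner_simps)
  then show ?thesis
    unfolding tmvn_kernel_def A_def[symmetric]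
    by (simp add: pairing_natural_stat exp_add[symmetric] inner_commute scaleR_matrix_vector_assoc[symmetric] field_simps)
qed

text \<open>
  Coercivity of \<open>S\<^sup>-\<^sup>1\<close> together with \<open>\<bar>w - m\<bar>\<^sup>2 \<ge> \<bar>w\<bar>\<^sup>2 / 2 - \<bar>m\<bar>\<^sup>2\<close> gives a centred Gaussian bound.
\<close>
lemma nn_integral_tmvn_kernel_finite:
  fixes S :: "real^'d^'d"
  assumes "pd_matrix S"
  shows "(\<integral>\<^sup>+w. ennreal (tmvn_kernel m S w) \<partial>lborel) < \<infinity>"
proof -
  obtain c where c: "c > 0" "\<And>v. c * (norm v)\<^sup>2 \<le> v \<bullet> (matrix_inv S *v v)"
    using pd_matrix_coercive[OF pd_matrix_matrix_inv[OF assms]] by blast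
  have bound: "tmvn_kernel m S w \<le> exp (c / 2 * (norm m)\<^sup>2) * exp (- (c / 4) * (norm w)\<^sup>2)" for w
  proof -
    \<comment> \<open>Half of this square is what the bound below leaves out.\<close>
    have "0 \<le> (norm (w - 2 *\<^sub>R m))\<^sup>2" by simp
    then have "(norm w)\<^sup>2 / 2 - (norm m)\<^sup>2 \<le> (norm (w - m))\<^sup>2"
      unfolding power2_norm_eq_inner by (simp add: inner_simps inner_commute)
    then have "c * ((norm w)\<^sup>2 / 2 - (norm m)\<^sup>2) \<le> c * (norm (w - m))\<^sup>2"
      using c(1) by (intro mult_left_mono) auto
    also have "\<dots> \<le> (w - m) \<bullet> (matrix_inv S *v (w - m))" by (rule c(2))
    finally show ?thesis
      by (simp add: tmvn_kernel_def exp_add[symmetric] algebra_simps)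
  qed
  have "(\<integral>\<^sup>+w. ennreal (tmvn_kernel m S w) \<partial>lborel)
    \<le> (\<integral>\<^sup>+w. ennreal (exp (c / 2 * (norm m)\<^sup>2)) * ennreal (exp (- (c / 4) * (norm (w::real^'d))\<^sup>2)) \<partial>lborel)"
    unfolding ennreal_mult''[symmetric, OF exp_ge_zero] by (intro nn_integral_mono ennreal_leI bound)
  also have "\<dots> = ennreal (exp (c / 2 * (norm m)\<^sup>2)) * (\<integral>\<^sup>+w. ennreal (exp (- (c / 4) * (norm (w::real^'d))\<^sup>2)) \<partial>lborel)"
    by (rule nn_integral_cmult) simp
  also have "\<dots> < \<infinity>"
    using nn_integral_gaussian_finite[of "c / 4", where 'a="real^'d"] c(1)
    by (auto simp: ennreal_mult_less_top)
  finally show ?thesis .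
qed

lemma tmvn_kernel_pos: "tmvn_kernel m S w > 0"
  by (simp add: tmvn_kernel_def)

lemma borel_measurable_tmvn_kernel [measurable]:
  "tmvn_kernel m S \<in> borel_measurable borel"
  unfolding tmvn_kernel_def by (intro borel_measurable_continuous_onI continuous_intros)

lemma borel_measurable_tmvn_density [measurable]:
  "tmvn_density m S \<in> borel_measurable borel"
  unfolding tmvn_density_def by measurable

lemma tmvn_const:
  fixes S :: "real^'d^'d"
  assumes "pd_matrix S"
  shows "(\<integral>\<^sup>+w. ennreal (tmvn_kernel m S w) * indicator nonneg_orthant w \<partial>lborel) = ennreal (tmvn_const m S)"
    and "tmvn_const m S > 0"
proof -
  have "integrable lborel (tmvn_kernel m S)"
    using nn_integral_tmvn_kernel_finite[OF assms]
    by (intro integrableI_nonneg) (auto simp: tmvn_kernel_pos less_imp_le)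
  then have "integrable lborel (\<lambda>w. indicator nonneg_orthant w *\<^sub>R tmvn_kernel m S w)"
    by (rule integrable_mult_indicator[rotated]) simp
  then have "(\<integral>\<^sup>+w. ennreal (indicator nonneg_orthant w *\<^sub>R tmvn_kernel m S w) \<partial>lborel) = ennreal (tmvn_const m S)"
    unfolding tmvn_const_def set_lebesgue_integral_def
    by (intro nn_integral_eq_integral) (auto simp: tmvn_kernel_pos less_imp_le)
  then show *: "(\<integral>\<^sup>+w. ennreal (tmvn_kernel m S w) * indicator nonneg_orthant w \<partial>lborel) = ennreal (tmvn_const m S)"
    by (subst (asm) nn_integral_cong[where v="\<lambda>w. ennreal (tmvn_kernel m S w) * indicator nonneg_orthant w"])
      (auto split: split_indicator)
  have "ennreal (tmvn_const m S) > 0"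
    unfolding *[symmetric] by (intro nn_integral_orthant_pos) (auto simp: tmvn_kernel_pos less_imp_le)
  then show "tmvn_const m S > 0" by simp
qed

lemma prob_space_tmvn:
  assumes "pd_matrix S"
  shows "prob_space (density lborel (\<lambda>w. ennreal (tmvn_density m S w)))"
proof (rule prob_spaceI)
  define C where "C = tmvn_const m S"
  have C: "C > 0" using tmvn_const(2)[OF assms] by (simp add: C_def)
  have "emeasure (density lborel (\<lambda>w. ennreal (tmvn_density m S w))) (space (density lborel (\<lambda>w. ennreal (tmvn_density m S w))))
     = (\<integral>\<^sup>+w. ennreal (tmvn_density m S w) \<partial>lborel)"
    by (subst emeasure_density) (auto intro!: nn_integral_cong)
  also have "\<dots> = (\<integral>\<^sup>+w. ennreal (inverse C) * (ennreal (tmvn_kernel m S w) * indicator nonneg_orthant w) \<partial>lborel)"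
    using C by (intro nn_integral_cong)
      (auto simp: tmvn_density_def C_def ennreal_mult' split: split_indicator)
  also have "\<dots> = ennreal (inverse C) * ennreal C"
    by (subst nn_integral_cmult) (auto simp: tmvn_const(1)[OF assms] C_def)
  also have "\<dots> = 1"
    using C by (simp add: ennreal_mult'[symmetric])
  finally show "emeasure (density lborel (\<lambda>w. ennreal (tmvn_density m S w))) (space (density lborel (\<lambda>w. ennreal (tmvn_density m S w)))) = 1" .
qed

lemma tmvn_density_exponential_family:
  assumes "pd_matrix S"
  obtains K q where "K > 0"
    "\<And>w. tmvn_density m S w = indicator nonneg_orthant w * (K * exp (pairing q (natural_stat w)))"
proof
  let ?A = "matrix_inv S"
  let ?K = "inverse (tmvn_const m S) * exp (- (1/2) * (m \<bullet> (?A *v m)))"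
  show "?K > 0"
    using tmvn_const(2)[OF assms] by simp
  show "tmvn_density m S w = indicator nonneg_orthant w *
      (?K * exp (pairing (?A *v m, (1/2) *\<^sub>R ?A) (natural_stat w)))" for w
    by (simp add: tmvn_density_def tmvn_kernel_canonical[OF assms])
qed

section \<open>Sufficiency\<close>

text \<open>
  The Fisher--Neyman factorization criterion, in the direction from factorization to sufficiency.
  For an event \<open>A\<close>, let \<open>\<nu>\<close> be the image under \<open>T\<close> of the restriction of \<open>P0\<close> to \<open>A\<close>, and let \<open>g\<close> be
  its Radon--Nikodym derivative with respect to the image of \<open>P0\<close>.  Then \<open>g \<circ> T\<close> is the conditional
  probability of \<open>A\<close> under \<open>P0\<close>, written from the outset as a function of \<open>T\<close>.  Under \<open>P p\<close> both sides
  of the defining identity get the additional factor \<open>h p \<circ> T\<close> in the integrand, and this factor is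
  carried through the change of variables.
\<close>
lemma sufficient_of_factorization:
  fixes h :: "'p \<Rightarrow> 'b \<Rightarrow> ennreal"
  assumes "prob_space P0" and sets_P0: "sets P0 = sets N"
    and T [measurable]: "T \<in> measurable N S"
    and h: "\<And>p. p \<in> \<Theta> \<Longrightarrow> h p \<in> borel_measurable S"
    and P: "\<And>p. p \<in> \<Theta> \<Longrightarrow> P p = density P0 (\<lambda>x. h p (T x))"
    and prob: "\<And>p. p \<in> \<Theta> \<Longrightarrow> prob_space (P p)"
  shows "sufficient N \<Theta> P S T"
  unfolding sufficient_def
proof (intro conjI ballI)
  interpret P0: prob_space P0 by fact
  have T0 [measurable]: "T \<in> measurable P0 S"
    using T by (simp add: measurable_cong_sets[OF sets_P0 refl])
  have space_P0: "space P0 = space N"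
    by (rule sets_eq_imp_space_eq) fact
  interpret D: prob_space "distr P0 S T" by (rule P0.prob_space_distr) fact
  fix A assume "A \<in> sets N"
  then have A [measurable]: "A \<in> sets P0" by (simp add: sets_P0)
  define \<nu> where "\<nu> = distr (density P0 (indicator A)) S T"
  have \<nu>_le: "emeasure \<nu> B \<le> emeasure (distr P0 S T) B" if "B \<in> sets S" for B
  proof -
    note [measurable] = that
    have "emeasure \<nu> B = emeasure P0 (A \<inter> (T -` B \<inter> space P0))"
      unfolding \<nu>_def by (simp add: emeasure_distr emeasure_density flip: indicator_inter_arith)
    also have "\<dots> \<le> emeasure (distr P0 S T) B"
      by (subst emeasure_distr) (auto intro!: emeasure_mono)
    finally show ?thesis .
  qed
  have ac: "absolutely_continuous (distr P0 S T) \<nu>"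
  proof -
    have "B \<in> null_sets \<nu>" if "B \<in> null_sets (distr P0 S T)" for B
      using that \<nu>_le[of B] by (auto simp: null_sets_def \<nu>_def)
    then show ?thesis by (auto simp: absolutely_continuous_def)
  qed
  have sets_\<nu> [simp]: "sets \<nu> = sets (distr P0 S T)" by (simp add: \<nu>_def)
  have "finite_measure \<nu>"
  proof (rule finite_measureI)
    have "emeasure \<nu> (space \<nu>) \<le> emeasure (distr P0 S T) (space S)"
      using \<nu>_le[of "space S"] by (simp add: \<nu>_def)
    also have "\<dots> < \<infinity>" by (simp add: D.emeasure_space_1[simplified])
    finally show "emeasure \<nu> (space \<nu>) \<noteq> \<infinity>" by auto
  qed
  then interpret \<nu>: finite_measure \<nu> .
  define g where "g = (\<lambda>t. enn2real (RN_deriv (distr P0 S T) \<nu> t))"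
  have g [measurable]: "g \<in> borel_measurable S"
    unfolding g_def using borel_measurable_RN_deriv[of "distr P0 S T" \<nu>] by measurable
  have "AE t in distr P0 S T. ennreal (g t) = RN_deriv (distr P0 S T) \<nu> t"
    using D.RN_deriv_finite[OF \<nu>.sigma_finite_measure_axioms ac sets_\<nu>]
    by eventually_elim (simp add: g_def less_top[symmetric])
  then have dens_g: "density (distr P0 S T) (\<lambda>t. ennreal (g t)) = \<nu>"
    using D.density_RN_deriv[OF ac sets_\<nu>]
    by (subst density_cong[where f'="RN_deriv (distr P0 S T) \<nu>"]) auto
  show "\<exists>g::'b \<Rightarrow> real. g \<in> borel_measurable S \<and>
        (\<forall>p\<in>\<Theta>. AE x in P p. real_cond_exp (P p) (vimage_algebra (space N) T S) (indicator A) x = g (T x))"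
  proof (intro exI[of _ g] conjI ballI g)
    fix p assume p: "p \<in> \<Theta>"
    note [measurable] = h[OF p]
    let ?F = "vimage_algebra (space N) T S"
    have sets_P: "sets (P p) = sets P0" by (simp add: P[OF p])
    have space_P: "space (P p) = space N" using sets_P space_P0 by (auto dest: sets_eq_imp_space_eq)
    interpret Pp: prob_space "P p" by (rule prob) fact
    have T_space: "T \<in> space N \<rightarrow> space S" using T by (rule measurable_space[THEN funcsetI])
    have T_P [measurable]: "T \<in> measurable (P p) S"
      using T0 by (simp add: measurable_cong_sets[OF sets_P refl])
    have subalg: "subalgebra (P p) ?F"
      using measurable_sets[OF T_P]
      by (auto simp: subalgebra_def space_P sets_vimage_algebra2[OF T_space])
    interpret F: finite_measure_subalgebra "P p" ?F
      using subalg by unfold_locales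
    have A_P [measurable]: "A \<in> sets (P p)" using A sets_P by simp
    \<comment> \<open>The defining identity of the conditional probability, tested on the event \<open>T \<in> B\<close>.\<close>
    have key: "(\<integral>\<^sup>+x. ennreal (g (T x)) * indicator B (T x) \<partial>P p) = emeasure (P p) (A \<inter> (T -` B \<inter> space N))"
      if [measurable]: "B \<in> sets S" for B
    proof -
      have "(\<integral>\<^sup>+x. ennreal (g (T x)) * indicator B (T x) \<partial>P p)
          = (\<integral>\<^sup>+x. h p (T x) * (ennreal (g (T x)) * indicator B (T x)) \<partial>P0)"
        unfolding P[OF p] by (subst nn_integral_density) auto
      also have "\<dots> = (\<integral>\<^sup>+t. h p t * (ennreal (g t) * indicator B t) \<partial>distr P0 S T)"
        by (subst nn_integral_distr) auto
      also have "\<dots> = (\<integral>\<^sup>+t. ennreal (g t) * (h p t * indicator B t) \<partial>distr P0 S T)"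
        by (simp add: mult_ac)
      also have "\<dots> = (\<integral>\<^sup>+t. h p t * indicator B t \<partial>\<nu>)"
        unfolding dens_g[symmetric] by (subst nn_integral_density) auto
      also have "\<dots> = (\<integral>\<^sup>+x. h p (T x) * indicator B (T x) \<partial>density P0 (indicator A))"
        unfolding \<nu>_def by (subst nn_integral_distr) auto
      also have "\<dots> = (\<integral>\<^sup>+x. h p (T x) * indicator (A \<inter> (T -` B \<inter> space N)) x \<partial>P0)"
        by (subst nn_integral_density)
          (auto intro!: nn_integral_cong simp: space_P0 split: split_indicator)
      also have "\<dots> = emeasure (P p) (A \<inter> (T -` B \<inter> space N))"
        unfolding P[OF p] by (subst emeasure_density) (auto simp: space_P0[symmetric])
      finally show ?thesis .
    qed
    have int_g: "integrable (P p) (\<lambda>x. g (T x))"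
    proof (rule integrableI_nonneg)
      have "(\<integral>\<^sup>+x. ennreal (g (T x)) \<partial>P p) = (\<integral>\<^sup>+x. ennreal (g (T x)) * indicator (space S) (T x) \<partial>P p)"
        using T_space by (intro nn_integral_cong) (auto simp: space_P split: split_indicator)
      also have "\<dots> < \<infinity>"
        by (subst key) (auto simp: less_top[symmetric])
      finally show "(\<integral>\<^sup>+x. ennreal (g (T x)) \<partial>P p) < \<infinity>" .
    qed (auto simp: g_def)
    show "AE x in P p. real_cond_exp (P p) ?F (indicator A) x = g (T x)"
    proof (rule F.real_cond_exp_charact)
      show "integrable (P p) (indicat_real A)"
        by (simp add: less_top[symmetric])
      show "integrable (P p) (\<lambda>x. g (T x))" by fact
      show "(\<lambda>x. g (T x)) \<in> borel_measurable ?F"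
        using measurable_vimage_algebra1[OF T_space] g by (rule measurable_compose)
      fix E assume "E \<in> sets ?F"
      then obtain B where B [measurable]: "B \<in> sets S" and E: "E = T -` B \<inter> space N"
        unfolding sets_vimage_algebra2[OF T_space] by blast
      have E_P [measurable]: "E \<in> sets (P p)"
        unfolding E space_P[symmetric] by measurable
      have "(\<integral>x\<in>E. g (T x) \<partial>P p) = enn2real (\<integral>\<^sup>+x. ennreal (indicator E x * g (T x)) \<partial>P p)"
        unfolding set_lebesgue_integral_def
        by (subst integral_eq_nn_integral) (auto simp: g_def)
      also have "(\<integral>\<^sup>+x. ennreal (indicator E x * g (T x)) \<partial>P p) = (\<integral>\<^sup>+x. ennreal (g (T x)) * indicator B (T x) \<partial>P p)"
        by (intro nn_integral_cong) (auto simp: E space_P split: split_indicator)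
      also have "enn2real \<dots> = measure (P p) (A \<inter> E)"
        by (subst key) (auto simp: E measure_def)
      also have "\<dots> = (\<integral>x\<in>E. indicator A x \<partial>P p)"
        unfolding set_lebesgue_integral_def
        by (simp add: indicator_inter_arith[symmetric] Int_commute)
      finally show "(\<integral>x\<in>E. indicator A x \<partial>P p) = (\<integral>x\<in>E. g (T x) \<partial>P p)" ..
    qed
  qed
next
  fix p assume "p \<in> \<Theta>"
  then show "prob_space (P p)" "sets (P p) = sets N"
    using prob P sets_P0 by auto
qed (rule T)

text \<open>
  A measure on the product is determined by its values on boxes, and both measures give a box the
  product of the masses of its sides, by Tonelli.
\<close>
lemma PiM_density:
  fixes r :: "'i \<Rightarrow> 'a \<Rightarrow> ennreal"
  assumes I: "finite I"
    and M: "\<And>i. prob_space (M i)"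
    and [measurable]: "\<And>i. r i \<in> borel_measurable (M i)"
    and D: "\<And>i. prob_space (density (M i) (r i))"
  shows "PiM I (\<lambda>i. density (M i) (r i)) = density (PiM I M) (\<lambda>x. \<Prod>i\<in>I. r i (x i))"
proof -
  interpret M: product_prob_space M
    using M by (simp add: product_prob_space_def product_prob_space_axioms_def product_sigma_finite_def prob_space_imp_sigma_finite)
  interpret D: product_prob_space "\<lambda>i. density (M i) (r i)"
    using D by (simp add: product_prob_space_def product_prob_space_axioms_def product_sigma_finite_def prob_space_imp_sigma_finite)
  show ?thesis
  proof (rule D.PiM_eqI[OF I, symmetric])
    show "sets (density (PiM I M) (\<lambda>x. \<Prod>i\<in>I. r i (x i))) = sets (PiM I (\<lambda>i. density (M i) (r i)))"
      by (simp cong: sets_PiM_cong)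
    fix A assume A: "\<And>i. i \<in> I \<Longrightarrow> A i \<in> sets (density (M i) (r i))"
    then have [measurable]: "\<And>i. i \<in> I \<Longrightarrow> A i \<in> sets (M i)" by simp
    have "emeasure (density (PiM I M) (\<lambda>x. \<Prod>i\<in>I. r i (x i))) (Pi\<^sub>E I A)
      = (\<integral>\<^sup>+x. (\<Prod>i\<in>I. r i (x i)) * indicator (Pi\<^sub>E I A) x \<partial>PiM I M)"
      using I by (subst emeasure_density) (auto intro!: sets_PiM_I_finite)
    also have "\<dots> = (\<integral>\<^sup>+x. (\<Prod>i\<in>I. r i (x i) * indicator (A i) (x i)) \<partial>PiM I M)"
    proof (intro nn_integral_cong)
      fix x assume "x \<in> space (PiM I M)"
      then have "indicator (Pi\<^sub>E I A) x = (\<Prod>i\<in>I. indicator (A i) (x i) :: ennreal)"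
        using I by (auto simp: space_PiM PiE_iff split: split_indicator)
      then show "(\<Prod>i\<in>I. r i (x i)) * indicator (Pi\<^sub>E I A) x = (\<Prod>i\<in>I. r i (x i) * indicator (A i) (x i))"
        by (simp add: prod.distrib)
    qed
    also have "\<dots> = (\<Prod>i\<in>I. \<integral>\<^sup>+w. r i w * indicator (A i) w \<partial>M i)"
      using I by (intro M.product_nn_integral_prod) auto
    also have "\<dots> = (\<Prod>i\<in>I. emeasure (density (M i) (r i)) (A i))"
      by (intro prod.cong) (auto simp: emeasure_density)
    finally show "emeasure (density (PiM I M) (\<lambda>x. \<Prod>i\<in>I. r i (x i))) (Pi\<^sub>E I A)
      = (\<Prod>i\<in>I. emeasure (density (M i) (r i)) (A i))" .
  qed
qed

lemma measurable_T12 [measurable]: "T12 n \<in> borel_measurable (PiM {1..n} (\<lambda>_. borel))"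
  unfolding T12_eq_mean[abs_def] by measurable

lemma T12_sufficient:
  assumes n: "n \<ge> 1"
  shows "sufficient (PiM {1..n} (\<lambda>_. borel)) {(m, S). pd_matrix S} (sample_law n) borel
           (T12 n :: (nat \<Rightarrow> real^'d) \<Rightarrow> (real^'d) \<times> (real^'d^'d))"
proof -
  let ?tm = "\<lambda>(m :: real^'d) S. density lborel (\<lambda>w. ennreal (tmvn_density m S w))"
  have law: "sample_law n (m, S) = PiM {1..n} (\<lambda>_. ?tm m S)" for m :: "real^'d" and S
    by (simp add: sample_law_def)
  have prob: "prob_space (sample_law n (m, S))" if "pd_matrix S" for m :: "real^'d" and S
    unfolding law by (intro prob_space_PiM prob_space_tmvn that)
  have pd1: "pd_matrix (mat 1 :: real^'d^'d)"
    by (simp add: pd_matrix_def sym_matrix_def)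
  define P0 where "P0 = sample_law n (0 :: real^'d, mat 1)"
  obtain K0 q0 where K0: "K0 > 0" and
    d0: "\<And>w. tmvn_density (0 :: real^'d) (mat 1) w = indicator nonneg_orthant w * (K0 * exp (pairing q0 (natural_stat w)))"
    using tmvn_density_exponential_family[OF pd1] by metis
  have "\<exists>h. h \<in> borel_measurable borel \<and> sample_law n p = density P0 (\<lambda>x. h (T12 n x))"
    if p_pd: "p \<in> {(m, S). pd_matrix S}" for p :: "(real^'d) \<times> (real^'d^'d)"
  proof -
    obtain m S where p: "p = (m, S)" and S: "pd_matrix S" using p_pd by auto
    obtain K q where K: "K > 0" and
      d: "\<And>w. tmvn_density m S w = indicator nonneg_orthant w * (K * exp (pairing q (natural_stat w)))"
      using tmvn_density_exponential_family[OF S] by metis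
    define r where "r w = K / K0 * exp (pairing (q - q0) (natural_stat w))" for w
    have r_pos: "r w > 0" for w using K K0 by (simp add: r_def)
    have r [measurable]: "r \<in> borel_measurable borel" unfolding r_def by measurable
    have ratio: "tmvn_density m S w = tmvn_density 0 (mat 1) w * r w" for w
      using K0 by (simp add: d d0 r_def linear_diff[OF linear_pairing_left] exp_diff)
    have nonneg0: "tmvn_density 0 (mat 1) w \<ge> 0" for w :: "real^'d"
      using K0 by (simp add: d0)
    have tm: "?tm m S = density (?tm 0 (mat 1)) (\<lambda>w. ennreal (r w))"
      by (subst density_density_eq)
        (auto intro!: density_cong simp: ratio ennreal_mult nonneg0 less_imp_le[OF r_pos])
    have prod: "(\<Prod>j=1..n. ennreal (r (x j))) =
        ennreal ((K / K0) ^ n * exp (real n * pairing (q - q0) (T12 n x)))" for x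
    proof -
      have "(\<Prod>j=1..n. r (x j)) = (K / K0) ^ n * exp (real n * pairing (q - q0) (T12 n x))"
        unfolding sum_pairing_natural_stat[OF n, symmetric] r_def prod.distrib by (simp add: exp_sum)
      then show ?thesis
        using r_pos by (simp add: prod_ennreal less_imp_le)
    qed
    have "sample_law n p = density P0 (\<lambda>x. \<Prod>j=1..n. ennreal (r (x j)))"
      unfolding p law tm P0_def
      by (intro PiM_density) (auto simp: tm[symmetric] intro: prob_space_tmvn S pd1)
    then have "sample_law n p =
        density P0 (\<lambda>x. ennreal ((K / K0) ^ n * exp (real n * pairing (q - q0) (T12 n x))))"
      by (simp only: prod)
    moreover have "(\<lambda>t. ennreal ((K / K0) ^ n * exp (real n * pairing (q - q0) t))) \<in> borel_measurable borel"
      by measurable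
    ultimately show ?thesis by blast
  qed
  then obtain h where h: "\<And>p. p \<in> {(m :: real^'d, S). pd_matrix S} \<Longrightarrow>
      h p \<in> borel_measurable borel \<and> sample_law n p = density P0 (\<lambda>x. h p (T12 n x))"
    by metis
  show ?thesis
  proof (rule sufficient_of_factorization)
    show "prob_space P0" unfolding P0_def by (intro prob pd1)
    show "sets P0 = sets (PiM {1..n} (\<lambda>_. borel))"
      unfolding P0_def law by (intro sets_PiM_cong) auto
  qed (use h prob measurable_T12 in auto)
qed

section \<open>The set of first and second moments\<close>

text \<open>
  The description of \<open>C_set\<close> by one scalar inequality for each \<open>v\<close>, on which all arguments about
  \<open>C_set\<close> are based.
\<close>
lemma C_set_iff:
  "(\<theta>, \<Theta>) \<in> C_set \<longleftrightarrow> \<theta> \<in> nonneg_orthant \<and> sym_matrix \<Theta> \<and> (\<forall>v. (\<theta> \<bullet> v)\<^sup>2 \<le> v \<bullet> (\<Theta> *v v))"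
proof -
  have "v \<bullet> ((\<Theta> - outer \<theta> \<theta>) *v v) = v \<bullet> (\<Theta> *v v) - (\<theta> \<bullet> v)\<^sup>2" for v
    by (simp add: matrix_vector_mult_diff_rdistrib inner_diff_right quadratic_form_outer)
  moreover have "sym_matrix (\<Theta> - outer \<theta> \<theta>) \<longleftrightarrow> sym_matrix \<Theta>"
    by (simp add: sym_matrix_def transpose_def outer_def vec_eq_iff mult.commute)
  ultimately show ?thesis
    by (simp add: C_set_def psd_matrix_def)
qed

lemma closed_C_set: "closed (C_set :: ((real^'d) \<times> (real^'d^'d)) set)"
proof -
  have "C_set = {z :: (real^'d) \<times> (real^'d^'d). (\<forall>i. 0 \<le> fst z $ i) \<and> (\<forall>i j. snd z $ j $ i = snd z $ i $ j) \<and>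
      (\<forall>v. (fst z \<bullet> v)\<^sup>2 \<le> v \<bullet> (snd z *v v))}"
    by (auto simp: C_set_iff nonneg_orthant_def sym_matrix_def transpose_def vec_eq_iff)
  also have "closed \<dots>"
    by (intro closed_Collect_conj closed_Collect_all closed_Collect_le closed_Collect_eq continuous_intros)
  finally show ?thesis .
qed

lemma convex_C_set: "convex (C_set :: ((real^'d) \<times> (real^'d^'d)) set)"
proof (rule convexI)
  fix y z :: "(real^'d) \<times> (real^'d^'d)" and a b :: real
  assume y: "y \<in> C_set" and z: "z \<in> C_set" and ab: "0 \<le> a" "0 \<le> b" "a + b = 1"
  obtain \<theta> \<Theta> \<eta> \<Psi> where yz: "y = (\<theta>, \<Theta>)" "z = (\<eta>, \<Psi>)" by fastforce
  have "((a *\<^sub>R \<theta> + b *\<^sub>R \<eta>) \<bullet> v)\<^sup>2 \<le> v \<bullet> ((a *\<^sub>R \<Theta> + b *\<^sub>R \<Psi>) *v v)" for v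
  proof -
    have "((a *\<^sub>R \<theta> + b *\<^sub>R \<eta>) \<bullet> v)\<^sup>2 = (a * (\<theta> \<bullet> v) + b * (\<eta> \<bullet> v))\<^sup>2"
      by (simp add: inner_simps)
    also have "\<dots> \<le> a * (\<theta> \<bullet> v)\<^sup>2 + b * (\<eta> \<bullet> v)\<^sup>2"
    proof -
      have a: "a = 1 - b" using ab by simp
      show ?thesis
        using convex_onD[OF convex_power2, of b "\<theta> \<bullet> v" "\<eta> \<bullet> v"] ab(1,2) by (simp add: a)
    qed
    also have "\<dots> \<le> a * (v \<bullet> (\<Theta> *v v)) + b * (v \<bullet> (\<Psi> *v v))"
      using y z ab by (intro add_mono mult_left_mono) (auto simp: yz C_set_iff)
    also have "\<dots> = v \<bullet> ((a *\<^sub>R \<Theta> + b *\<^sub>R \<Psi>) *v v)"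
      by (simp add: matrix_vector_mult_add_rdistrib inner_simps scaleR_matrix_vector_assoc[symmetric])
    finally show ?thesis .
  qed
  moreover have "a *\<^sub>R \<theta> + b *\<^sub>R \<eta> \<in> nonneg_orthant"
    using y z ab by (auto simp: yz C_set_iff nonneg_orthant_def)
  moreover have "sym_matrix (a *\<^sub>R \<Theta> + b *\<^sub>R \<Psi>)"
    using y z by (simp add: yz C_set_iff sym_matrix_def transpose_def vec_eq_iff)
  ultimately show "a *\<^sub>R y + b *\<^sub>R z \<in> C_set"
    by (simp add: yz C_set_iff)
qed

lemma sym_matrix_T2: "sym_matrix (T2 n x)"
  by (simp add: sym_matrix_def transpose_def T2_def outer_def vec_eq_iff mult.commute)

text \<open>
  The second moment minus the square of the mean is the variance, here of the numbers \<open>x j \<bullet> v\<close>.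
\<close>
lemma sample_variance_identity:
  assumes "n \<ge> 1"
  shows "v \<bullet> (T2 n x *v v) - (T1 n x \<bullet> v)\<^sup>2 = (\<Sum>j=1..n. ((x j - T1 n x) \<bullet> v)\<^sup>2) / real n"
proof -
  have T2: "v \<bullet> (T2 n x *v v) = (\<Sum>j=1..n. (x j \<bullet> v)\<^sup>2) / real n"
    unfolding quadratic_form_eq_inner_outer T2_def
    by (simp add: inner_sum_left quadratic_form_outer[unfolded quadratic_form_eq_inner_outer])
  have T1: "real n * (T1 n x \<bullet> v) = (\<Sum>j=1..n. x j \<bullet> v)"
    using assms by (simp add: T1_def inner_sum_left)
  have "(\<Sum>j=1..n. ((x j - T1 n x) \<bullet> v)\<^sup>2)
      = (\<Sum>j=1..n. (x j \<bullet> v)\<^sup>2 - 2 * (T1 n x \<bullet> v) * (x j \<bullet> v) + (T1 n x \<bullet> v)\<^sup>2)"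
    by (simp add: inner_diff_left power2_diff algebra_simps)
  also have "\<dots> = (\<Sum>j=1..n. (x j \<bullet> v)\<^sup>2) - 2 * (T1 n x \<bullet> v) * (\<Sum>j=1..n. x j \<bullet> v) + real n * (T1 n x \<bullet> v)\<^sup>2"
    by (simp add: sum.distrib sum_subtractf sum_distrib_left)
  also have "\<dots> = (\<Sum>j=1..n. (x j \<bullet> v)\<^sup>2) - real n * (T1 n x \<bullet> v)\<^sup>2"
    unfolding T1[symmetric] by (simp add: power2_eq_square)
  finally show ?thesis
    using assms by (simp add: T2 field_simps)
qed

lemma T12_in_C_set:
  assumes "n \<ge> 1" and "\<And>j. j \<in> {1..n} \<Longrightarrow> x j \<in> nonneg_orthant"
  shows "T12 n x \<in> C_set"
proof -
  have "(T1 n x \<bullet> v)\<^sup>2 \<le> v \<bullet> (T2 n x *v v)" for v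
    using sample_variance_identity[OF assms(1), of v x]
      sum_nonneg[of "{1..n}" "\<lambda>j. ((x j - T1 n x) \<bullet> v)\<^sup>2"]
    by (smt (verit) divide_nonneg_nonneg of_nat_0_le_iff zero_le_power2)
  moreover have "T1 n x \<in> nonneg_orthant"
    using assms(2) by (auto simp: nonneg_orthant_def T1_def intro!: divide_nonneg_nonneg sum_nonneg)
  ultimately show ?thesis
    by (simp add: T12_def C_set_iff sym_matrix_T2)
qed

text \<open>
  If no nonzero \<open>v\<close> is orthogonal to all differences of observations, the defining inequality of
  \<open>C_set\<close> is strict for all unit vectors \<open>v\<close>.  Strictness on the compact sphere is an open condition
  on the pair: the pairs that violate it form the projection of a closed set along the sphere.
\<close>
lemma T12_in_interior_C_set:
  fixes x :: "nat \<Rightarrow> real^'d"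
  assumes "n \<ge> 1" and pos: "\<And>j. j \<in> {1..n} \<Longrightarrow> x j \<in> pos_orthant"
    and span: "\<And>v. (\<And>j. j \<in> {1..n} \<Longrightarrow> (x j - x 1) \<bullet> v = 0) \<Longrightarrow> v = 0"
  shows "T12 n x \<in> top_of_set vec_sym_space interior_of C_set"
proof -
  let ?bad = "{(v, z). v \<bullet> (snd z *v v) \<le> (fst z \<bullet> v)\<^sup>2} :: ((real^'d) \<times> (real^'d) \<times> (real^'d^'d)) set"
  let ?proj = "{z. \<exists>v. v \<in> sphere 0 1 \<and> (v, z) \<in> ?bad} :: ((real^'d) \<times> (real^'d^'d)) set"
  define U where "U = {z :: (real^'d) \<times> (real^'d^'d). fst z \<in> pos_orthant} \<inter> - ?proj"
  have "?bad = {p. fst p \<bullet> (snd (snd p) *v fst p) \<le> (fst (snd p) \<bullet> fst p)\<^sup>2}"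
    by auto
  also have "closed \<dots>"
    by (intro closed_Collect_le continuous_intros)
  finally have "closed ?proj"
    by (intro closed_compact_projection) auto
  moreover have "open {z :: (real^'d) \<times> (real^'d^'d). fst z \<in> pos_orthant}"
    using open_vimage_fst[OF open_pos_orthant] by (simp add: vimage_def)
  ultimately have U: "open U" unfolding U_def by (intro open_Int) auto
  have "z \<in> C_set" if "z \<in> U" "z \<in> vec_sym_space" for z
  proof -
    obtain \<theta> \<Theta> where z: "z = (\<theta>, \<Theta>)" by fastforce
    have "(\<theta> \<bullet> v)\<^sup>2 \<le> v \<bullet> (\<Theta> *v v)" for v
    proof (cases "v = 0")
      case False
      define w where "w = v /\<^sub>R norm v"
      have w: "w \<in> sphere 0 1" and v: "v = norm v *\<^sub>R w"
        using False by (auto simp: w_def)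
      then have "(\<theta> \<bullet> w)\<^sup>2 \<le> w \<bullet> (\<Theta> *v w)"
        using that(1) by (force simp: U_def z)
      then have "(norm v)\<^sup>2 * (\<theta> \<bullet> w)\<^sup>2 \<le> (norm v)\<^sup>2 * (w \<bullet> (\<Theta> *v w))"
        by (intro mult_left_mono) auto
      then show ?thesis
        by (subst (1 2 3) v) (simp add: matrix_vector_mult_scaleR power2_eq_square mult_ac)
    qed simp
    then show ?thesis
      using that pos_orthant_subset by (auto simp: z C_set_iff U_def vec_sym_space_def)
  qed
  moreover have "T12 n x \<in> U"
  proof -
    have "(T1 n x \<bullet> v)\<^sup>2 < v \<bullet> (T2 n x *v v)" if "v \<in> sphere 0 1" for v
    proof -
      have "v \<noteq> 0" using that by auto
      have "(\<Sum>j=1..n. ((x j - T1 n x) \<bullet> v)\<^sup>2) \<noteq> 0"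
      proof
        assume "(\<Sum>j=1..n. ((x j - T1 n x) \<bullet> v)\<^sup>2) = 0"
        then have "(x j - T1 n x) \<bullet> v = 0" if "j \<in> {1..n}" for j
          using that by (subst (asm) sum_nonneg_eq_0_iff) auto
        then have "(x j - x 1) \<bullet> v = 0" if "j \<in> {1..n}" for j
          using that assms(1) by (simp add: inner_diff_left)
        then show False using span \<open>v \<noteq> 0\<close> by blast
      qed
      then have "(\<Sum>j=1..n. ((x j - T1 n x) \<bullet> v)\<^sup>2) / real n > 0"
        using assms(1) sum_nonneg[of "{1..n}" "\<lambda>j. ((x j - T1 n x) \<bullet> v)\<^sup>2"]
        by (auto simp: less_le)
      then show ?thesis
        using sample_variance_identity[OF assms(1), of v x] by simp
    qed
    moreover have "T1 n x \<in> pos_orthant"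
      using assms(1) pos by (auto simp: pos_orthant_def T1_def intro!: divide_pos_pos sum_pos)
    ultimately show ?thesis
      by (force simp: U_def T12_def)
  qed
  moreover have "T12 n x \<in> vec_sym_space"
    by (simp add: T12_def vec_sym_space_def sym_matrix_T2)
  moreover have "openin (top_of_set vec_sym_space) (vec_sym_space \<inter> U)"
    using U by (rule openin_open_Int)
  ultimately show ?thesis
    unfolding interior_of_def by blast
qed

text \<open>
  The complement of \<open>S\<close> is an open null set, hence misses the support.
\<close>
lemma convex_support_subset:
  assumes "prob_space M" and [measurable]: "T \<in> borel_measurable M"
    and S: "closed S" "convex S" and AE: "AE \<omega> in M. T \<omega> \<in> S"
  shows "convex_support (distr M borel T) \<subseteq> S"
proof -
  interpret prob_space M by fact
  have "measure_support (distr M borel T) \<subseteq> S"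
  proof
    fix z assume z: "z \<in> measure_support (distr M borel T)"
    show "z \<in> S"
    proof (rule ccontr)
      assume "z \<notin> S"
      then have "emeasure (distr M borel T) (- S) > 0"
        using z S(1) by (auto simp: measure_support_def open_Compl)
      moreover have "emeasure (distr M borel T) (- S) = 0"
      proof -
        have [measurable]: "S \<in> sets borel" using S(1) by (rule borel_closed)
        have "emeasure (distr M borel T) (- S) = emeasure M {\<omega> \<in> space M. T \<omega> \<notin> S}"
          by (subst emeasure_distr) (auto intro!: arg_cong[where f="emeasure M"])
        also have "\<dots> = 0"
          using AE by (subst (asm) AE_iff_measurable[OF _ refl]) auto
        finally show ?thesis .
      qed
      ultimately show False by simp
    qed
  qed
  then show ?thesis
    unfolding convex_support_def
    using S by (intro closure_minimal hull_minimal)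
qed

section \<open>General position of the sample\<close>

text \<open>
  Tonelli for null sets: almost every value of the coordinates in \<open>I\<close> first, then the coordinate \<open>i\<close>.
\<close>
lemma (in product_sigma_finite) AE_PiM_insert:
  assumes I: "finite I" "i \<notin> I" and [measurable]: "Measurable.pred (PiM (insert i I) M) P"
    and AE: "AE x in PiM I M. AE y in M i. P (x(i := y))"
  shows "AE z in PiM (insert i I) M. P z"
proof -
  have "(\<integral>\<^sup>+z. (if P z then 0 else 1) \<partial>PiM (insert i I) M) = (\<integral>\<^sup>+x. \<integral>\<^sup>+y. (if P (x(i := y)) then 0 else 1) \<partial>M i \<partial>PiM I M)"
    using I by (intro product_nn_integral_insert) auto
  also have "\<dots> = (\<integral>\<^sup>+x. 0 \<partial>PiM I M)"
  proof (rule nn_integral_cong_AE)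
    show "AE x in PiM I M. (\<integral>\<^sup>+y. (if P (x(i := y)) then 0 else 1) \<partial>M i) = 0"
      using AE
    proof eventually_elim
      case (elim x)
      then have "(\<integral>\<^sup>+y. (if P (x(i := y)) then 0 else 1) \<partial>M i) = (\<integral>\<^sup>+y. 0 \<partial>M i)"
        by (intro nn_integral_cong_AE) (auto elim!: eventually_mono)
      then show ?case by simp
    qed
  qed
  finally show ?thesis
    by (simp add: nn_integral_0_iff_AE split: if_splits)
qed

text \<open>
  The same with the coordinate \<open>i\<close> drawn first.
\<close>
lemma (in product_sigma_finite) AE_PiM_insert_rev:
  assumes I: "finite I" "i \<notin> I" and [measurable]: "Measurable.pred (PiM (insert i I) M) P"
    and AE: "AE y in M i. AE x in PiM I M. P (x(i := y))"
  shows "AE z in PiM (insert i I) M. P z"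
proof -
  have "(\<integral>\<^sup>+z. (if P z then 0 else 1) \<partial>PiM (insert i I) M) = (\<integral>\<^sup>+y. \<integral>\<^sup>+x. (if P (x(i := y)) then 0 else 1) \<partial>PiM I M \<partial>M i)"
    using I by (intro product_nn_integral_insert_rev) auto
  also have "\<dots> = (\<integral>\<^sup>+y. 0 \<partial>M i)"
  proof (rule nn_integral_cong_AE)
    show "AE y in M i. (\<integral>\<^sup>+x. (if P (x(i := y)) then 0 else 1) \<partial>PiM I M) = 0"
      using AE
    proof eventually_elim
      case (elim y)
      then have "(\<integral>\<^sup>+x. (if P (x(i := y)) then 0 else 1) \<partial>PiM I M) = (\<integral>\<^sup>+x. 0 \<partial>PiM I M)"
        by (intro nn_integral_cong_AE) (auto elim!: eventually_mono)
      then show ?case by simp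
    qed
  qed
  finally show ?thesis
    by (simp add: nn_integral_0_iff_AE split: if_splits)
qed

text \<open>
  The zero set is a hyperplane or empty.
\<close>
lemma AE_affine_nonzero:
  fixes M :: "'a::euclidean_space measure"
  assumes M: "sets M = sets borel" "absolutely_continuous lborel M"
    and b: "a + b \<bullet> z \<noteq> 0"
  shows "AE y in M. a + b \<bullet> y \<noteq> (0 :: real)"
proof -
  have "{y. b \<bullet> y = - a} = {y. a + b \<bullet> y = 0}" by (auto simp: algebra_simps)
  moreover have "b \<noteq> 0 \<or> - a \<noteq> 0" using b by auto
  ultimately have "negligible {y. a + b \<bullet> y = 0}"
    using negligible_hyperplane[of b "- a"] by simp
  moreover have "{y. a + b \<bullet> y = 0} \<in> sets borel"
    by (intro borel_closed closed_Collect_eq continuous_intros)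
  ultimately have "{y. a + b \<bullet> y = 0} \<in> null_sets lborel"
    by (simp add: negligible_iff_null_sets null_sets_def emeasure_completion)
  then have "{y. a + b \<bullet> y = 0} \<in> null_sets M"
    using M(2) by (auto simp: absolutely_continuous_def)
  then show ?thesis
    by (rule AE_I') auto
qed

text \<open>
  Induction on the coordinates.  Fix the coordinate \<open>i\<close> at its value in \<open>x0\<close>: by induction \<open>f\<close> is then
  nonzero for almost all values of the other coordinates.  For each of these, \<open>f\<close> is a nonzero
  affine function of the coordinate \<open>i\<close> alone.
\<close>
lemma AE_multiaffine_nonzero:
  fixes M :: "'i \<Rightarrow> 'a::euclidean_space measure" and f :: "('i \<Rightarrow> 'a) \<Rightarrow> real"
  assumes M: "product_sigma_finite M" "\<And>i. sets (M i) = sets borel" "\<And>i. absolutely_continuous lborel (M i)"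
    and "finite I"
    and "f \<in> borel_measurable (PiM I M)"
    and "\<And>i x. i \<in> I \<Longrightarrow> \<exists>a b. \<forall>y. f (x(i := y)) = a + b \<bullet> y"
    and "x0 \<in> space (PiM I M)" "f x0 \<noteq> 0"
  shows "AE x in PiM I M. f x \<noteq> 0"
  using assms(4-)
proof (induction I arbitrary: f x0 rule: finite_induct)
  case empty
  then show ?case by (auto simp: space_PiM)
next
  case (insert i I)
  interpret product_sigma_finite M by fact
  note [measurable] = insert.prems(1)
  have space_M: "space (M j) = UNIV" for j
    using sets_eq_imp_space_eq[OF M(2)[of j]] by simp
  define c where "c = x0 i"
  have "AE x in PiM I M. f (x(i := c)) \<noteq> 0"
  proof (rule insert.IH)
    show "(\<lambda>x. f (x(i := c))) \<in> borel_measurable (PiM I M)"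
      by (rule measurable_compose[OF measurable_fun_upd[where J=I and i=i] insert.prems(1)])
        (auto simp: space_M)
    show "\<exists>a b. \<forall>y. f ((x(j := y))(i := c)) = a + b \<bullet> y" if "j \<in> I" for j x
      using insert.prems(2)[of j "x(i := c)"] insert.hyps(2) that by (metis fun_upd_twist insertCI)
    show "x0(i := undefined) \<in> space (PiM I M)"
      using insert.prems(3) insert.hyps(2) by (auto simp: space_PiM PiE_iff extensional_def)
    show "f ((x0(i := undefined))(i := c)) \<noteq> 0"
      using insert.prems(4) by (simp add: c_def)
  qed
  then have "AE x in PiM I M. AE y in M i. f (x(i := y)) \<noteq> 0"
  proof eventually_elim
    case (elim x)
    obtain a b where ab: "\<And>y. f (x(i := y)) = a + b \<bullet> y"
      using insert.prems(2)[OF insertI1] by blast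
    then show ?case
      using elim AE_affine_nonzero[OF M(2,3), of a b c i] by simp
  qed
  then show ?case
    by (intro AE_PiM_insert insert.hyps) measurable
qed

lemma det_affine_in_row:
  fixes w :: "'n::finite \<Rightarrow> real^'n"
  shows "\<exists>a b. \<forall>y::real^'n. det (\<chi> i. if i = k then y - z else w i) = a + b \<bullet> y"
proof -
  let ?D = "\<lambda>y::real^'n. det (\<chi> i. if i = k then y else w i)"
  have lin: "linear ?D"
    by (rule linearI) (simp_all add: det_row_add[of k] det_row_mul[where 'a=real and k=k, unfolded scalar_mult_eq_scaleR])
  \<comment> \<open>The coefficient vector of the linear functional \<open>?D\<close> is the image of \<open>1\<close> under its adjoint.\<close>
  have "?D (y - z) = - ?D z + adjoint ?D 1 \<bullet> y" for y
    using adjoint_works[OF lin, of y 1] by (simp add: linear_diff[OF lin] inner_commute)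
  then show ?thesis by blast
qed


lemma borel_measurable_det [measurable (raw)]:
  fixes F :: "'a \<Rightarrow> 'n::finite \<Rightarrow> real^'n"
  assumes [measurable]: "\<And>i. (\<lambda>x. F x i) \<in> borel_measurable M"
  shows "(\<lambda>x. det (\<chi> i. F x i)) \<in> borel_measurable M"
  unfolding det_def vec_lambda_beta cart_eq_inner_axis by measurable

text \<open>
  A sample that fails this lies on a common hyperplane.  With \<open>e\<close> selecting \<open>d\<close> of the observations
  \<open>2, \<dots>, n\<close>, it suffices that the determinant with rows \<open>x (e i) - x 1\<close> is nonzero.
  Observation \<open>1\<close> is drawn first, because for fixed \<open>x 1\<close> the determinant is visibly affine in each of
  the remaining observations.
\<close>
lemma AE_general_position:
  fixes M :: "(real^'d) measure"
  assumes M: "prob_space M" "sets M = sets borel" "absolutely_continuous lborel M"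
    and n: "n > CARD('d)"
  shows "AE x in PiM {1..n} (\<lambda>_. M). \<forall>v. (\<forall>j\<in>{1..n}. (x j - x 1) \<bullet> v = 0) \<longrightarrow> v = 0"
proof -
  interpret prob_space M by fact
  interpret product_sigma_finite "\<lambda>_::nat. M" by unfold_locales
  have space_M: "space M = UNIV"
    using sets_eq_imp_space_eq[OF M(2)] by simp
  have "card (UNIV :: 'd set) \<le> card {2..n}" using n by simp
  then obtain e :: "'d \<Rightarrow> nat" where e: "inj e" "range e \<subseteq> {2..n}"
    using card_le_inj[of "UNIV :: 'd set" "{2..n}"] by auto
  have e_in: "e i \<in> {2..n}" for i
    using e(2) by blast
  have e_ne: "e i \<noteq> 1" for i
    using e_in[of i] by auto
  have insert: "{1..n} = insert 1 {2..n}" using n by auto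
  define D where "D z x = det (\<chi> i. x (e i) - z)" for z and x :: "nat \<Rightarrow> real^'d"
  have comp: "(\<lambda>x. x j) \<in> borel_measurable (PiM J (\<lambda>_. M))" if "j \<in> J" for j :: nat and J
    using measurable_component_singleton[OF that, of "\<lambda>_. M"] M(2)
    by (simp add: measurable_cong_sets[OF refl M(2)])
  have AE_D: "AE x in PiM {2..n} (\<lambda>_. M). D z x \<noteq> 0" for z
  proof (rule AE_multiaffine_nonzero)
    show "D z \<in> borel_measurable (PiM {2..n} (\<lambda>_. M))"
      unfolding D_def by (intro borel_measurable_det borel_measurable_diff borel_measurable_const comp e_in)
    show "\<exists>a b. \<forall>y. D z (x(k := y)) = a + b \<bullet> y" if "k \<in> {2..n}" for k x
    proof (cases "k \<in> range e")
      case True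
      then obtain i where i: "k = e i" by blast
      have "D z (x(k := y)) = det (\<chi> i'. if i' = i then y - z else x (e i') - z)" for y :: "real^'d"
        unfolding D_def i using e(1)
        by (intro arg_cong[where f=det]) (auto simp: vec_eq_iff inj_eq)
      then show ?thesis
        using det_affine_in_row[of i z "\<lambda>i'. x (e i') - z"] by simp
    next
      case False
      then have "e i \<noteq> k" for i by blast
      then have "D z (x(k := y)) = D z x + 0 \<bullet> y" for y
        by (simp add: D_def)
      then show ?thesis by blast
    qed
    \<comment> \<open>Observations for which the matrix of differences is the identity.\<close>
    define x0 where "x0 = (\<lambda>j\<in>{2..n}. z + axis (inv e j) (1::real))"
    show "x0 \<in> space (PiM {2..n} (\<lambda>_. M))"
      by (simp add: x0_def space_PiM space_M)
    have "(\<chi> i. x0 (e i) - z) = mat 1"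
      using e_in by (simp add: x0_def vec_eq_iff mat_def axis_def inv_f_f[OF e(1)] eq_commute)
    then show "D z x0 \<noteq> 0"
      by (simp add: D_def)
  qed (use M in \<open>auto intro: product_sigma_finite_axioms\<close>)
  have "AE x in PiM (insert 1 {2..n}) (\<lambda>_. M). D (x 1) x \<noteq> 0"
  proof (rule AE_PiM_insert_rev)
    show "Measurable.pred (PiM (insert 1 {2..n}) (\<lambda>_. M)) (\<lambda>x. D (x 1) x \<noteq> 0)"
    proof -
      have "(\<lambda>x. D (x 1) x) \<in> borel_measurable (PiM (insert 1 {2..n}) (\<lambda>_. M))"
        unfolding D_def by (intro borel_measurable_det borel_measurable_diff comp insertI1 insertI2 e_in)
      then show ?thesis by measurable
    qed
    have "D y (x(1 := y)) = D y x" for x y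
      using e_ne by (simp add: D_def)
    then show "AE y in M. AE x in PiM {2..n} (\<lambda>_. M). D ((x(1 := y)) 1) (x(1 := y)) \<noteq> 0"
      using AE_D by simp
  qed auto
  then show ?thesis
    unfolding insert
  proof eventually_elim
    case (elim x)
    show ?case
    proof (intro allI impI)
      fix v assume v: "\<forall>j\<in>insert 1 {2..n}. (x j - x 1) \<bullet> v = 0"
      let ?A = "\<chi> i. x (e i) - x 1"
      have "?A *v v = 0"
        using v e_in by (simp add: vec_eq_iff matrix_vector_mul_component)
      moreover have "inj ((*v) ?A)"
        using elim by (simp add: D_def invertible_det_nz[symmetric] invertible_eq_bij bij_is_inj)
      ultimately show "v = 0"
        by (metis injD matrix_vector_mult_0_right)
    qed
  qed
qed

section \<open>Uniqueness of the maximum likelihood estimator\<close>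

text \<open>
  Identifiability of the canonical parameters.  By continuity the function is constant on the open
  orthant.  Along a ray it is a polynomial in the scale without constant term, so both its linear and
  its quadratic coefficient vanish; polarization and the fact that positive vectors span the space
  then give that \<open>r\<close> vanishes.
\<close>
lemma pairing_constant_on_orthant_imp_zero:
  fixes r :: "(real^'d) \<times> (real^'d^'d)"
  assumes "sym_matrix (snd r)"
    and AE: "AE w in lborel. w \<in> nonneg_orthant \<longrightarrow> pairing r (natural_stat w) = c"
  shows "r = 0"
proof -
  obtain \<theta> \<Theta> where r: "r = (\<theta>, \<Theta>)" by fastforce
  have all: "pairing r (natural_stat w) = c" if "w \<in> pos_orthant" for w
  proof (rule AE_lborel_open_imp_all[OF _ open_pos_orthant _ that])
    show "AE w in lborel. w \<in> pos_orthant \<longrightarrow> pairing r (natural_stat w) = c"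
      using AE by eventually_elim (use pos_orthant_subset in auto)
    have "{w \<in> pos_orthant. pairing r (natural_stat w) \<noteq> c} = pos_orthant \<inter> {w. pairing r (natural_stat w) \<noteq> c}"
      by auto
    also have "open \<dots>"
      by (intro open_Int open_pos_orthant open_Collect_neq continuous_intros)
    finally show "open {w \<in> pos_orthant. pairing r (natural_stat w) \<noteq> c}" .
  qed
  have lin: "\<theta> \<bullet> w = 0" and quad: "w \<bullet> (\<Theta> *v w) = 0" if w: "w \<in> pos_orthant" for w
  proof -
    have "k * (\<theta> \<bullet> w) - k\<^sup>2 * (w \<bullet> (\<Theta> *v w)) = c" if "k > 0" for k
      using all[of "k *\<^sub>R w"] w that
      by (simp add: r pairing_natural_stat matrix_vector_mult_scaleR pos_orthant_def power2_eq_square mult.assoc)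
    \<comment> \<open>Three scales determine the two coefficients and the constant \<open>c\<close>.\<close>
    from this[of 1] this[of 2] this[of 3] show "\<theta> \<bullet> w = 0" "w \<bullet> (\<Theta> *v w) = 0"
      by simp_all
  qed
  have diff: "\<exists>a b. a \<in> pos_orthant \<and> b \<in> pos_orthant \<and> u = a - b" for u :: "real^'d"
  proof (intro exI conjI)
    show "(\<chi> i. \<bar>u $ i\<bar> + 1) \<in> pos_orthant" "(\<chi> i. \<bar>u $ i\<bar> + 1 - u $ i) \<in> pos_orthant"
      by (auto simp: pos_orthant_def)
    show "u = (\<chi> i. \<bar>u $ i\<bar> + 1) - (\<chi> i. \<bar>u $ i\<bar> + 1 - u $ i)"
      by (simp add: vec_eq_iff)
  qed
  have bilin: "a \<bullet> (\<Theta> *v b) = 0" if "a \<in> pos_orthant" "b \<in> pos_orthant" for a b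
  proof -
    have "a + b \<in> pos_orthant" using that by (auto simp: pos_orthant_def add_pos_pos)
    then have "a \<bullet> (\<Theta> *v b) + b \<bullet> (\<Theta> *v a) = 0"
      using quad[of "a + b"] quad[OF that(1)] quad[OF that(2)]
      by (simp add: matrix_vector_right_distrib inner_add_left inner_add_right)
    moreover have "b \<bullet> (\<Theta> *v a) = a \<bullet> (\<Theta> *v b)"
      using assms(1) by (metis dot_lmul_matrix inner_commute transpose_matrix_vector r snd_conv sym_matrix_def)
    ultimately show ?thesis by simp
  qed
  have "\<theta> \<bullet> u = 0" for u
    using diff[of u] lin by (auto simp: inner_diff_right)
  then have "\<theta> = 0" by (metis inner_eq_zero_iff)
  moreover have "u \<bullet> (\<Theta> *v u') = 0" for u u'
  proof -
    obtain a b a' b' where "a \<in> pos_orthant" "b \<in> pos_orthant" "u = a - b"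
      "a' \<in> pos_orthant" "b' \<in> pos_orthant" "u' = a' - b'"
      using diff by metis
    then show ?thesis
      using bilin by (simp add: matrix_vector_mult_diff_distrib inner_diff_left inner_diff_right)
  qed
  then have "\<Theta> *v u = 0 *v u" for u
    by (metis inner_eq_zero_iff matrix_vector_mult_0)
  then have "\<Theta> = 0" by (simp add: matrix_eq)
  ultimately show ?thesis by (simp add: r zero_prod_def)
qed

definition partition_function :: "(real^'d) \<times> (real^'d^'d) \<Rightarrow> real" where
  "partition_function p = enn2real (L_T (fst p) (snd p))"

lemma canonical_space_integrable:
  assumes "p \<in> canonical_space"
  shows "integrable lborel (\<lambda>w. indicator nonneg_orthant w * exp (pairing p (natural_stat w)))"
    and "(\<integral>w. indicator nonneg_orthant w * exp (pairing p (natural_stat w)) \<partial>lborel) = partition_function p"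
    and "partition_function p > 0"
proof -
  let ?F = "\<lambda>w. indicator nonneg_orthant w * exp (pairing p (natural_stat w))"
  have L: "L_T (fst p) (snd p) = (\<integral>\<^sup>+w. ennreal (?F w) \<partial>lborel)"
    unfolding L_T_def
    by (intro nn_integral_cong) (auto simp: pairing_natural_stat[symmetric] split: split_indicator)
  have fin: "L_T (fst p) (snd p) < \<infinity>"
    using assms by (auto simp: canonical_space_def)
  show int: "integrable lborel ?F"
    using fin unfolding L by (intro integrableI_nonneg) auto
  show "(\<integral>w. ?F w \<partial>lborel) = partition_function p"
    unfolding partition_function_def L by (intro integral_eq_nn_integral) auto
  have "L_T (fst p) (snd p) > 0"
    unfolding L_T_def pairing_natural_stat[symmetric] by (intro nn_integral_orthant_pos) auto
  then show "partition_function p > 0"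
    using fin by (simp add: partition_function_def enn2real_positive_iff)
qed

text \<open>
  The equality case of the Cauchy--Schwarz inequality.  With \<open>u\<^sup>2\<close> and \<open>v\<^sup>2\<close> the densities for \<open>p\<close> and
  \<open>q\<close>, the unnormalized density at the midpoint is a constant times \<open>u v\<close>.  Compare it with the same
  constant times \<open>(u\<^sup>2 + v\<^sup>2) / 2\<close>, whose integral is known; the difference is a multiple of \<open>(u - v)\<^sup>2\<close>,
  and if its integral were zero the two densities would agree, contradicting identifiability.
\<close>
lemma midpoint_canonical_space:
  assumes p: "p \<in> canonical_space" and q: "q \<in> canonical_space" and "p \<noteq> q"
  defines "m \<equiv> (1/2) *\<^sub>R (p + q)"
  shows "m \<in> canonical_space"
    and "ln (partition_function m) < (ln (partition_function p) + ln (partition_function q)) / 2"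
proof -
  let ?ind = "indicator nonneg_orthant :: real^'a \<Rightarrow> real"
  define a b where "a = ln (partition_function p)" and "b = ln (partition_function q)"
  define f where "f r w = exp (pairing r (natural_stat w))" for r and w :: "real^'a"
  have [measurable]: "f r \<in> borel_measurable borel" for r unfolding f_def by measurable
  define u v where "u w = exp ((pairing p (natural_stat w) - a) / 2)"
    and "v w = exp ((pairing q (natural_stat w) - b) / 2)" for w
  have pairing_m: "pairing m t = (pairing p t + pairing q t) / 2" for t
    by (simp add: m_def linear_scale[OF linear_pairing_left] linear_add[OF linear_pairing_left])
  have f_m: "f m w = exp ((a + b) / 2) * (u w * v w)" for w
    by (simp add: f_def u_def v_def pairing_m exp_add[symmetric] field_simps)
  have u2: "(u w)\<^sup>2 = f p w / partition_function p" and v2: "(v w)\<^sup>2 = f q w / partition_function q" for w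
  proof -
    have "(exp (y / 2))\<^sup>2 = exp y" for y :: real
      by (simp add: power2_eq_square exp_add[symmetric])
    then show "(u w)\<^sup>2 = f p w / partition_function p" "(v w)\<^sup>2 = f q w / partition_function q"
      using canonical_space_integrable(3)[OF p] canonical_space_integrable(3)[OF q]
      by (simp_all add: f_def u_def v_def a_def b_def exp_diff)
  qed
  define G where "G w = exp ((a + b) / 2) / 2 * (?ind w * (u w)\<^sup>2 + ?ind w * (v w)\<^sup>2)" for w
  have int_u: "integrable lborel (\<lambda>w. ?ind w * (u w)\<^sup>2)" "(\<integral>w. ?ind w * (u w)\<^sup>2 \<partial>lborel) = 1"
    using canonical_space_integrable[OF p] by (simp_all add: u2 f_def)
  have int_v: "integrable lborel (\<lambda>w. ?ind w * (v w)\<^sup>2)" "(\<integral>w. ?ind w * (v w)\<^sup>2 \<partial>lborel) = 1"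
    using canonical_space_integrable[OF q] by (simp_all add: v2 f_def)
  have int_G: "integrable lborel G" "(\<integral>w. G w \<partial>lborel) = exp ((a + b) / 2)"
    unfolding G_def using int_u int_v by simp_all
  have gap: "G w - ?ind w * f m w = exp ((a + b) / 2) / 2 * (?ind w * (u w - v w)\<^sup>2)" for w
    by (simp add: G_def f_m power2_diff algebra_simps)
  have le: "?ind w * f m w \<le> G w" for w
    using gap[of w] by (smt (verit) exp_ge_zero divide_nonneg_pos indicator_pos_le mult_nonneg_nonneg zero_le_power2)
  have int_m: "integrable lborel (\<lambda>w. ?ind w * f m w)"
    using int_G(1) by (rule Bochner_Integration.integrable_bound) (use le in \<open>auto simp: f_def intro: order_trans[OF _ abs_ge_self]\<close>)
  have L: "L_T (fst m) (snd m) = (\<integral>\<^sup>+w. ennreal (?ind w * f m w) \<partial>lborel)"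
    unfolding L_T_def f_def
    by (intro nn_integral_cong) (auto simp: pairing_natural_stat[symmetric] split: split_indicator)
  have "L_T (fst m) (snd m) < \<infinity>"
    unfolding L using int_m by (subst nn_integral_eq_integral) (auto simp: f_def)
  moreover have sym: "sym_matrix (snd p)" "sym_matrix (snd q)"
    using p q by (auto simp: canonical_space_def)
  ultimately show m: "m \<in> canonical_space"
    unfolding canonical_space_def case_prod_beta mem_Collect_eq
    by (simp add: m_def sym_matrix_def transpose_def vec_eq_iff)
  have "(\<integral>w. ?ind w * f m w \<partial>lborel) \<noteq> exp ((a + b) / 2)"
  proof
    assume "(\<integral>w. ?ind w * f m w \<partial>lborel) = exp ((a + b) / 2)"
    then have "(\<integral>w. G w - ?ind w * f m w \<partial>lborel) = 0"
      using int_G int_m by simp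
    then have "AE w in lborel. G w - ?ind w * f m w = 0"
      using int_G(1) int_m le by (subst (asm) integral_nonneg_eq_0_iff_AE) auto
    then have "AE w in lborel. w \<in> nonneg_orthant \<longrightarrow> pairing (p - q) (natural_stat w) = a - b"
      by eventually_elim
        (auto simp: gap u_def v_def linear_diff[OF linear_pairing_left] field_simps split: split_indicator_asm)
    then have "p - q = 0"
      using sym by (intro pairing_constant_on_orthant_imp_zero)
        (auto simp: sym_matrix_def transpose_def vec_eq_iff)
    then show False using \<open>p \<noteq> q\<close> by simp
  qed
  moreover have "(\<integral>w. ?ind w * f m w \<partial>lborel) \<le> exp ((a + b) / 2)"
    unfolding int_G(2)[symmetric] by (intro integral_mono int_m int_G le)
  ultimately have "partition_function m < exp ((a + b) / 2)"
    using canonical_space_integrable(2)[OF m] by (simp add: f_def)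
  then have "ln (partition_function m) < ln (exp ((a + b) / 2))"
    using canonical_space_integrable(3)[OF m] by (subst ln_less_cancel_iff) auto
  then show "ln (partition_function m) < (ln (partition_function p) + ln (partition_function q)) / 2"
    by (simp add: a_def[symmetric] b_def[symmetric])
qed

lemma likelihood_eq_exp:
  assumes "p \<in> canonical_space" "n \<ge> 1" "\<And>j. j \<in> {1..n} \<Longrightarrow> x j \<in> nonneg_orthant"
  shows "likelihood n x p = exp (real n * (pairing p (T12 n x) - ln (partition_function p)))"
proof -
  have L: "partition_function p > 0"
    by (rule canonical_space_integrable) fact
  obtain \<theta> \<Theta> where p: "p = (\<theta>, \<Theta>)" by fastforce
  have "likelihood n x p = (\<Prod>j=1..n. exp (pairing p (natural_stat (x j)) - ln (partition_function p)))"
    unfolding likelihood_def p prod.case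
    by (intro prod.cong)
      (use assms(3) L in \<open>auto simp: p canonical_density_def partition_function_def pairing_natural_stat exp_diff\<close>)
  also have "\<dots> = exp (\<Sum>j=1..n. pairing p (natural_stat (x j)) - ln (partition_function p))"
    by (simp add: exp_sum)
  also have "(\<Sum>j=1..n. pairing p (natural_stat (x j)) - ln (partition_function p))
      = real n * (pairing p (T12 n x) - ln (partition_function p))"
    by (simp only: sum_subtractf sum_pairing_natural_stat[OF assms(2)]) (simp add: right_diff_distrib)
  finally show ?thesis .
qed

text \<open>
  The log-likelihood is \<open>n\<close> times the difference of a linear and a strictly convex function, so
  at the midpoint it exceeds the average of its values at \<open>p\<close> and \<open>q\<close>.
\<close>
lemma likelihood_arg_max_unique:
  assumes n: "n \<ge> 1" and x: "\<And>j. j \<in> {1..n} \<Longrightarrow> x j \<in> nonneg_orthant"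
    and p: "is_arg_max (likelihood n x) (\<lambda>p. p \<in> canonical_space) p"
    and q: "is_arg_max (likelihood n x) (\<lambda>p. p \<in> canonical_space) q"
  shows "p = q"
proof (rule ccontr)
  assume "p \<noteq> q"
  define m where "m = (1/2) *\<^sub>R (p + q)"
  have pc: "p \<in> canonical_space" and qc: "q \<in> canonical_space"
    using p q by (auto simp: is_arg_max_def)
  note mid = midpoint_canonical_space[OF pc qc \<open>p \<noteq> q\<close>, folded m_def]
  define l where "l r = pairing r (T12 n x) - ln (partition_function r)" for r
  have lik: "likelihood n x r = exp (real n * l r)" if "r \<in> canonical_space" for r
    using likelihood_eq_exp[OF that n x] by (simp add: l_def)
  have "l m \<le> l p" "l m \<le> l q"
    using p q mid(1) n lik[OF pc] lik[OF qc] lik[OF mid(1)]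
    unfolding is_arg_max_def by (metis exp_less_cancel_iff mult_less_cancel_left_pos not_less of_nat_0_less_iff zero_less_one order_less_le_trans)+
  moreover have "pairing m t = (pairing p t + pairing q t) / 2" for t
    by (simp add: m_def linear_scale[OF linear_pairing_left] linear_add[OF linear_pairing_left])
  then have "l m > (l p + l q) / 2"
    using mid(2) by (simp add: l_def diff_divide_distrib add_divide_distrib)
  ultimately show False by simp
qed

section \<open>The law of a truncated normal sample\<close>

text \<open>
  The boundary of the orthant is contained in the union of the coordinate hyperplanes.
\<close>
lemma AE_tmvn_pos_orthant:
  fixes S :: "real^'d^'d"
  shows "AE w in density lborel (\<lambda>w. ennreal (tmvn_density m S w)). w \<in> pos_orthant"
proof -
  have "AE w in lborel. (w :: real^'d) $ i \<noteq> 0" for i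
    using AE_affine_nonzero[of lborel 0 "axis i (1::real)" "axis i 1"]
    by (simp add: absolutely_continuous_def inner_axis')
  then have "AE w in lborel. \<forall>i. (w :: real^'d) $ i \<noteq> 0"
    by (intro eventually_all_finite)
  then have "AE w in lborel. 0 < ennreal (tmvn_density m S w) \<longrightarrow> w \<in> pos_orthant"
    by eventually_elim
      (auto simp: tmvn_density_def nonneg_orthant_def pos_orthant_def less_le split: split_indicator)
  then show ?thesis
    by (subst AE_density) auto
qed

lemma borel_measurable_T12_compose:
  assumes "\<And>j. j \<in> {1..n} \<Longrightarrow> x j \<in> borel_measurable M"
  shows "(\<lambda>\<omega>. T12 n (\<lambda>j. x j \<omega>)) \<in> borel_measurable M"
  unfolding T12_eq_mean
  by (intro borel_measurable_scaleR borel_measurable_const borel_measurable_sum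
      measurable_compose[OF _ borel_measurable_natural_stat] assms)

theorem theorem4p1:
  fixes M :: "'a measure"
    and x :: "nat \<Rightarrow> 'a \<Rightarrow> real^'d"
    and \<mu> :: "real^'d" and \<Sigma> :: "real^'d^'d"
    and n :: nat
  assumes "n \<ge> 1"
    and "pd_matrix \<Sigma>"
    and "prob_space M"
    and "prob_space.indep_vars M (\<lambda>_. borel) x {1..n}"
    and "\<And>j. j \<in> {1..n} \<Longrightarrow> distributed M lborel (x j) (\<lambda>w. ennreal (tmvn_density \<mu> \<Sigma> w))"
  shows "sufficient (PiM {1..n} (\<lambda>_. borel)) {(m, S). pd_matrix S} (sample_law n) borel
           (T12 n :: (nat \<Rightarrow> real^'d) \<Rightarrow> (real^'d) \<times> (real^'d^'d))
       \<and> (closed (C_set :: ((real^'d) \<times> (real^'d^'d)) set)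
          \<and> convex (C_set :: ((real^'d) \<times> (real^'d^'d)) set)
          \<and> convex_support (distr M borel (\<lambda>\<omega>. T12 n (\<lambda>j. x j \<omega>))) \<subseteq> C_set)
       \<and> (n > CARD('d) \<longrightarrow>
            (AE \<omega> in M. T12 n (\<lambda>j. x j \<omega>) \<in> top_of_set vec_sym_space interior_of C_set)
          \<and> (\<forall>\<omega>\<in>space M. (\<forall>j\<in>{1..n}. x j \<omega> \<in> nonneg_orthant) \<longrightarrow>
               (\<exists>p. is_arg_max (likelihood n (\<lambda>j. x j \<omega>)) (\<lambda>p. p \<in> canonical_space) p) \<longrightarrow>
               (\<exists>!p. is_arg_max (likelihood n (\<lambda>j. x j \<omega>)) (\<lambda>p. p \<in> canonical_space) p)))"
proof -
  interpret prob_space M by fact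
  define \<nu> where "\<nu> = density lborel (\<lambda>w. ennreal (tmvn_density \<mu> \<Sigma> w))"
  have \<nu>: "prob_space \<nu>" "sets \<nu> = sets borel" "absolutely_continuous lborel \<nu>"
    unfolding \<nu>_def by (auto intro!: prob_space_tmvn assms absolutely_continuousI_density)
  have x_meas: "x j \<in> borel_measurable M" if "j \<in> {1..n}" for j
    using distributed_measurable[OF assms(5)[OF that]] by simp
  have x_distr: "distr M borel (x j) = \<nu>" if "j \<in> {1..n}" for j
    using distributed_distr_eq_density[OF assms(5)[OF that]] by (simp add: \<nu>_def cong: distr_cong)
  have x_pos: "AE \<omega> in M. \<forall>j\<in>{1..n}. x j \<omega> \<in> pos_orthant"
  proof (rule AE_finite_allI)
    fix j assume j: "j \<in> {1..n}"
    have "AE w in distr M borel (x j). w \<in> pos_orthant"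
      unfolding x_distr[OF j] \<nu>_def by (rule AE_tmvn_pos_orthant)
    then show "AE \<omega> in M. x j \<omega> \<in> pos_orthant"
      by (rule AE_distrD[OF x_meas[OF j]])
  qed simp
  have support: "convex_support (distr M borel (\<lambda>\<omega>. T12 n (\<lambda>j. x j \<omega>))) \<subseteq> C_set"
  proof (rule convex_support_subset)
    show "AE \<omega> in M. T12 n (\<lambda>j. x j \<omega>) \<in> C_set"
      using x_pos
    proof eventually_elim
      case (elim \<omega>)
      then show ?case
        using pos_orthant_subset by (intro T12_in_C_set assms) auto
    qed
  qed (auto intro: assms(3) closed_C_set convex_C_set borel_measurable_T12_compose x_meas)
  have interior: "AE \<omega> in M. T12 n (\<lambda>j. x j \<omega>) \<in> top_of_set vec_sym_space interior_of C_set"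
    if n: "n > CARD('d)"
  proof -
    \<comment> \<open>Product measures live on functions that are undefined off the index set, hence the restriction.\<close>
    define X where "X \<omega> = (\<lambda>j\<in>{1..n}. x j \<omega>)" for \<omega>
    have X: "X \<in> measurable M (PiM {1..n} (\<lambda>_. borel))"
      unfolding X_def by (intro measurable_restrict x_meas)
    have "distr M (PiM {1..n} (\<lambda>_. borel)) X = PiM {1..n} (\<lambda>j. distr M borel (x j))"
      using assms(1,4) x_meas unfolding X_def by (subst (asm) indep_vars_iff_distr_eq_PiM') auto
    also have "\<dots> = PiM {1..n} (\<lambda>_. \<nu>)"
      by (intro PiM_cong) (auto simp: x_distr)
    finally have law: "distr M (PiM {1..n} (\<lambda>_. borel)) X = PiM {1..n} (\<lambda>_. \<nu>)" .
    have "AE y in distr M (PiM {1..n} (\<lambda>_. borel)) X.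
        \<forall>v. (\<forall>j\<in>{1..n}. (y j - y 1) \<bullet> v = 0) \<longrightarrow> v = 0"
      unfolding law by (rule AE_general_position[OF \<nu> n])
    then have "AE \<omega> in M. \<forall>v. (\<forall>j\<in>{1..n}. (X \<omega> j - X \<omega> 1) \<bullet> v = 0) \<longrightarrow> v = 0"
      by (rule AE_distrD[OF X])
    with x_pos show ?thesis
    proof eventually_elim
      case (elim \<omega>)
      then show ?case
        using assms(1) by (intro T12_in_interior_C_set) (auto simp: X_def)
    qed
  qed
  have unique: "\<exists>!p. is_arg_max (likelihood n (\<lambda>j. x j \<omega>)) (\<lambda>p. p \<in> canonical_space) p"
    if "\<forall>j\<in>{1..n}. x j \<omega> \<in> nonneg_orthant"
      "\<exists>p. is_arg_max (likelihood n (\<lambda>j. x j \<omega>)) (\<lambda>p. p \<in> canonical_space) p" for \<omega>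
    using that likelihood_arg_max_unique[OF assms(1), of "\<lambda>j. x j \<omega>"] by blast
  show ?thesis
    using T12_sufficient[OF assms(1)] closed_C_set convex_C_set support interior unique by blast
qed

end
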